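(* Let $\Lambda,\Lambda'$ be two relatively-separated subsets of $\mathbb{R}^d$, and let $A=(a(\lambda,\lambda'))_{\lambda\in\Lambda,\lambda'\in\Lambda'}$ be an infinite matrix in the Sjöstrand class $\mathcal{C}(\Lambda,\Lambda')$. If $A$ has $\ell^p$-stability for some $1\le p\le\infty$, then $A$ has $\ell^q$-stability for all $1\le q\le\infty$.
   Context: A discrete subset $\Lambda$ of $\mathbb{R}^d$ is relatively-separated if $R(\Lambda)=\sup_{x\in\mathbb{R}^d}\sum_{\lambda\in\Lambda}\chi_{\lambda+[0,1)^d}(x)<\infty$, where $\chi_E$ denotes the characteristic function of $E$. For relatively-separated $\Lambda,\Lambda'\subset\mathbb{R}^d$, the Sjöstrand class $\mathcal{C}(\Lambda,\Lambda')$ consists of all matrices $A=(a(\lambda,\lambda'))_{\lambda\in\Lambda,\lambda'\in\Lambda'}$ with $\|A\|_{\mathcal{C}}:=\sum_{k\in\mathbb{Z}^d}\sup_{\lambda\in\Lambda,\lambda'\in\Lambda'}|a(\lambda,\lambda')|\chi_{k+[0,1)^d}(\lambda-\lambda')<\infty$. Such $A$ acts from $\ell^p(\Lambda')$ to $\ell^p(\Lambda)$ by $(Ac)(\lambda)=\sum_{\lambda'\in\Lambda'}a(\lambda,\lambda')c(\lambda')$, where $\ell^p(\Lambda)$ is the space of $p$-summable sequences on $\Lambda$ with standard norm. $A$ has $\ell^p$-stability if there exists a positive constant $C$ such that $C^{-1}\|c\|_{\ell^p(\Lambda')}\le\|Ac\|_{\ell^p(\Lambda)}\le C\|c\|_{\ell^p(\Lambda')}$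 for all $c\in\ell^p(\Lambda')$. *)

theory Defs
  imports "HOL-Analysis.Analysis"
begin

definition unit_cube :: "(real ^ 'n) set" where
  "unit_cube = {x. \<forall>i. 0 \<le> x $ i \<and> x $ i < 1}"

definition int_vec :: "int ^ 'n \<Rightarrow> real ^ 'n" where
  "int_vec k = (\<chi> i. of_int (k $ i))"

text \<open>
  The sums and suprema in the next three definitions are taken in \<^typ>\<open>ennreal\<close>, where they
  always exist (the supremum over the empty set being \<open>0\<close>), so that \<open>< \<infinity>\<close> is a genuine
  finiteness condition.
\<close>

definition separation_bound :: "(real ^ 'n) set \<Rightarrow> ennreal" where
  "separation_bound \<Lambda> = (SUP x. \<Sum>\<^sub>\<infinity>\<mu>\<in>\<Lambda>. indicator ((+) \<mu> ` unit_cube) x)"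

definition relatively_separated :: "(real ^ 'n) set \<Rightarrow> bool" where
  "relatively_separated \<Lambda> \<longleftrightarrow> discrete \<Lambda> \<and> separation_bound \<Lambda> < \<infinity>"

text \<open>
  A matrix indexed by \<open>\<Lambda> \<times> \<Lambda>'\<close> is a function of two arguments and a sequence on \<open>\<Lambda>\<close> a function of
  one argument; their values outside the index sets are never used.
\<close>

definition sjostrand_norm ::
  "(real ^ 'n) set \<Rightarrow> (real ^ 'n) set \<Rightarrow> (real ^ 'n \<Rightarrow> real ^ 'n \<Rightarrow> complex) \<Rightarrow> ennreal" where
  "sjostrand_norm \<Lambda> \<Lambda>' a =
     (\<Sum>\<^sub>\<infinity>k\<in>UNIV. SUP (\<mu>, \<nu>) \<in> \<Lambda> \<times> \<Lambda>'.
        ennreal (norm (a \<mu> \<nu>)) * indicator ((+) (int_vec k) ` unit_cube) (\<mu> - \<nu>))"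

definition sjostrand_class ::
  "(real ^ 'n) set \<Rightarrow> (real ^ 'n) set \<Rightarrow> (real ^ 'n \<Rightarrow> real ^ 'n \<Rightarrow> complex) set" where
  "sjostrand_class \<Lambda> \<Lambda>' = {a. sjostrand_norm \<Lambda> \<Lambda>' a < \<infinity>}"

definition ell_space :: "ereal \<Rightarrow> 'a set \<Rightarrow> ('a \<Rightarrow> complex) set" where
  "ell_space p \<Lambda> =
     (if p = \<infinity> then {c. bdd_above ((\<lambda>\<mu>. norm (c \<mu>)) ` \<Lambda>)}
      else {c. (\<lambda>\<mu>. norm (c \<mu>) powr real_of_ereal p) summable_on \<Lambda>})"

text \<open>
  Inserting \<open>0\<close> only matters for empty \<open>\<Lambda>\<close>, where the supremum of reals would be unspecified.
  The value is meaningful for \<open>1 \<le> p\<close> and members of \<^const>\<open>ell_space\<close>.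
\<close>

definition ell_norm :: "ereal \<Rightarrow> 'a set \<Rightarrow> ('a \<Rightarrow> complex) \<Rightarrow> real" where
  "ell_norm p \<Lambda> c =
     (if p = \<infinity> then Sup (insert 0 ((\<lambda>\<mu>. norm (c \<mu>)) ` \<Lambda>))
      else (\<Sum>\<^sub>\<infinity>\<mu>\<in>\<Lambda>. norm (c \<mu>) powr real_of_ereal p) powr (1 / real_of_ereal p))"

definition mat_apply :: "'b set \<Rightarrow> ('a \<Rightarrow> 'b \<Rightarrow> complex) \<Rightarrow> ('b \<Rightarrow> complex) \<Rightarrow> 'a \<Rightarrow> complex" where
  "mat_apply \<Lambda>' a c = (\<lambda>\<mu>. \<Sum>\<^sub>\<infinity>\<nu>\<in>\<Lambda>'. a \<mu> \<nu> * c \<nu>)"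

text \<open>
  Since \<^const>\<open>ell_norm\<close> is real-valued, the finiteness of the norm of \<open>A c\<close> that is implicit in the
  two-sided estimate is stated separately.
\<close>

definition ell_stable ::
  "ereal \<Rightarrow> 'a set \<Rightarrow> 'b set \<Rightarrow> ('a \<Rightarrow> 'b \<Rightarrow> complex) \<Rightarrow> bool" where
  "ell_stable p \<Lambda> \<Lambda>' a \<longleftrightarrow>
     (\<exists>C>0. \<forall>c\<in>ell_space p \<Lambda>'.
        mat_apply \<Lambda>' a c \<in> ell_space p \<Lambda> \<and>
        inverse C * ell_norm p \<Lambda>' c \<le> ell_norm p \<Lambda> (mat_apply \<Lambda>' a c) \<and>
        ell_norm p \<Lambda> (mat_apply \<Lambda>' a c) \<le> C * ell_norm p \<Lambda>' c)"

end

theory Submission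
  imports Defs
begin

text \<open>
  Cut \<open>\<real>\<^sup>d\<close> into cubes \<open>B n\<close> of side \<open>N\<close> and let \<open>w n\<close> be a bounded Lipschitz window with constant
  \<open>1 / N\<close> which is at least one on \<open>B n\<close> and vanishes far from it. Applying stability in \<open>\<ell>\<^sup>p\<close> to
  \<open>w n * c\<close> and commuting the window with \<open>A\<close> bounds the local norm \<open>V n\<close> of \<open>c\<close> on \<open>B n\<close> (in \<open>\<ell>\<^sup>p\<close>)
  by a convolution of the local norms \<open>W m\<close> of \<open>A c\<close> plus a convolution \<open>\<Sum>m. g (n - m) * V m\<close>
  coming from the commutators. By dominated convergence the \<open>\<ell>\<^sup>1\<close>-norm of \<open>g\<close> tends to zero as \<open>N\<close> grows;
  no rate is needed, because the exponent is changed only afterwards: taking \<open>\<ell>\<^sup>q\<close>-norms in \<open>n\<close> for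
  one fixed large \<open>N\<close>, the commutator term is absorbed into the left-hand side, and for fixed \<open>N\<close> the
  \<open>\<ell>\<^sup>q\<close>-norm of the local \<open>\<ell>\<^sup>p\<close>-norms is equivalent to the \<open>\<ell>\<^sup>q\<close>-norm, as each cube contains boundedly
  many points.
\<close>

subsection \<open>Norms of extended nonnegative sequences\<close>

text \<open>Sending \<open>top\<close> to \<open>top\<close> and 0 to 0 for every exponent keeps
  \<open>epow\<close> multiplicative and makes \<open>epow (1 / p)\<close> the inverse of
  \<open>epow p\<close> for every nonzero \<open>p\<close>.\<close>

definition epow :: "real \<Rightarrow> ennreal \<Rightarrow> ennreal" where
  "epow p x = (if x = top then top else ennreal (enn2real x powr p))"

lemma epow_top [simp]: "epow p top = top"
  by (simp add: epow_def)

lemma epow_0 [simp]: "epow p 0 = 0"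
  by (simp add: epow_def)

lemma epow_ennreal: "0 \<le> x \<Longrightarrow> epow p (ennreal x) = ennreal (x powr p)"
  by (simp add: epow_def)

lemma epow_of_1 [simp]: "epow p 1 = 1"
  using epow_ennreal[of 1 p] by simp

lemma epow_exponent_1 [simp]: "epow 1 x = x"
  by (cases x) (auto simp: epow_ennreal)

lemma epow_eq_0_iff [simp]: "epow p x = 0 \<longleftrightarrow> x = 0"
  by (cases x) (auto simp: epow_ennreal ennreal_eq_0_iff)

lemma epow_eq_top_iff [simp]: "epow p x = top \<longleftrightarrow> x = top"
  by (cases x) (auto simp: epow_ennreal)

lemma epow_mono: "0 \<le> p \<Longrightarrow> x \<le> y \<Longrightarrow> epow p x \<le> epow p y"
  by (cases x; cases y) (auto simp: epow_ennreal top_unique intro!: powr_mono2 ennreal_leI)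

lemma epow_mult: "epow p (x * y) = epow p x * epow p y"
proof (cases "x = 0 \<or> y = 0")
  case False
  show ?thesis
  proof (cases "x = top \<or> y = top")
    case True
    with False show ?thesis
      by (auto simp: ennreal_mult_top ennreal_top_mult)
  next
    case finite: False
    then obtain r s where "0 \<le> r" "x = ennreal r" "0 \<le> s" "y = ennreal s"
      by (cases x; cases y) auto
    then show ?thesis
      by (simp add: epow_ennreal powr_mult flip: ennreal_mult)
  qed
qed auto

lemma epow_epow_inverse:
  assumes "p \<noteq> 0"
  shows "epow p (epow (1 / p) x) = x" "epow (1 / p) (epow p x) = x"
  using assms by (cases x; simp add: epow_ennreal powr_powr)+

text \<open>The l^p norm over the whole index type, with value \<open>top\<close> in case of
  divergence, so that estimates and interchanges of sums carry no summability conditions.\<close>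

definition enorm :: "ereal \<Rightarrow> ('a \<Rightarrow> ennreal) \<Rightarrow> ennreal" where
  "enorm p f = (if p = \<infinity> then SUP x. f x
     else epow (1 / real_of_ereal p) (\<integral>\<^sup>+x. epow (real_of_ereal p) (f x) \<partial>count_space UNIV))"

lemma enorm_infinity: "enorm \<infinity> f = (SUP x. f x)"
  by (simp add: enorm_def)

lemma enorm_real:
  "enorm (ereal p) f = epow (1 / p) (\<integral>\<^sup>+x. epow p (f x) \<partial>count_space UNIV)"
  by (simp add: enorm_def)

lemma epow_enorm:
  "p \<noteq> 0 \<Longrightarrow> epow p (enorm (ereal p) f) = (\<integral>\<^sup>+x. epow p (f x) \<partial>count_space UNIV)"
  by (simp add: enorm_real epow_epow_inverse)

lemma enorm_real_le_iff:
  assumes "0 < p"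
  shows "enorm (ereal p) f \<le> t \<longleftrightarrow> (\<integral>\<^sup>+x. epow p (f x) \<partial>count_space UNIV) \<le> epow p t"
  using assms epow_enorm[of p f] epow_mono[of p] epow_mono[of "1 / p"]
  by (metis divide_nonneg_nonneg epow_epow_inverse(2) less_eq_real_def less_irrefl zero_le_one)

lemma ereal_ge_1_cases:
  assumes "1 \<le> (p :: ereal)"
  obtains (real) r where "p = ereal r" "1 \<le> r" | (infinity) "p = \<infinity>"
  using assms by (cases p) auto

lemma enorm_mono:
  assumes p: "1 \<le> p" and le: "\<And>x. f x \<le> g x"
  shows "enorm p f \<le> enorm p g"
  using p
proof (cases rule: ereal_ge_1_cases)
  case (real r)
  then show ?thesis
    by (auto simp: enorm_real intro!: epow_mono nn_integral_mono le)
qed (auto simp: enorm_infinity intro!: SUP_mono le)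

lemma enorm_cmult:
  assumes p: "1 \<le> p"
  shows "enorm p (\<lambda>x. t * f x) = t * enorm p f"
  using p
proof (cases rule: ereal_ge_1_cases)
  case (real r)
  then show ?thesis
    by (auto simp: enorm_real epow_mult nn_integral_cmult epow_epow_inverse)
qed (auto simp: enorm_infinity SUP_mult_left_ennreal)

lemma le_nn_integral_count_space:
  fixes f :: "'a \<Rightarrow> ennreal"
  shows "f x \<le> (\<integral>\<^sup>+y. f y \<partial>count_space UNIV)"
proof -
  have "f x = (\<integral>\<^sup>+y. f y * indicator {x} y \<partial>count_space UNIV)"
    by simp
  also have "\<dots> \<le> (\<integral>\<^sup>+y. f y \<partial>count_space UNIV)"
    by (intro nn_integral_mono) (auto split: split_indicator)
  finally show ?thesis .
qed

lemma le_enorm: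
  assumes p: "1 \<le> p"
  shows "f x \<le> enorm p f"
  using p
proof (cases rule: ereal_ge_1_cases)
  case (real r)
  have "epow (1 / r) (epow r (f x)) \<le> enorm p f"
    unfolding real enorm_real using real by (intro epow_mono le_nn_integral_count_space) auto
  then show ?thesis
    using real by (simp add: epow_epow_inverse)
qed (auto simp: enorm_infinity intro: SUP_upper)

lemma enorm_infinity_less_top:
  assumes "1 \<le> q" "enorm q f < top"
  shows "enorm \<infinity> f < top"
proof -
  have "enorm \<infinity> f \<le> enorm q f"
    unfolding enorm_infinity by (intro SUP_least le_enorm assms)
  then show ?thesis
    using assms(2) by (rule order_le_less_trans)
qed

lemma enorm_eq_0_iff:
  assumes p: "1 \<le> p"
  shows "enorm p f = 0 \<longleftrightarrow> (\<forall>x. f x = 0)"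
proof
  assume "enorm p f = 0"
  then show "\<forall>x. f x = 0"
    using le_enorm[OF p, of f] by auto
next
  assume "\<forall>x. f x = 0"
  then have "f = (\<lambda>x. 0 * f x)"
    by auto
  then show "enorm p f = 0"
    using enorm_cmult[OF p, of 0 f] by simp
qed

lemma enorm_indicator_singleton:
  assumes p: "1 \<le> p"
  shows "enorm p (\<lambda>x. t * indicator {y} x) = t"
proof -
  have "enorm p (indicator {y}) = 1"
    using p
  proof (cases rule: ereal_ge_1_cases)
    case (real r)
    have "epow r (indicator {y} x) = indicator {y} x" for x
      by (simp split: split_indicator)
    then show ?thesis
      by (simp add: real enorm_real)
  next
    case infinity
    have "(SUP x. indicator {y} x :: ennreal) = 1"
      by (rule antisym) (auto intro!: SUP_least SUP_upper2[of y] split: split_indicator)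
    then show ?thesis
      by (simp add: infinity enorm_infinity)
  qed
  then show ?thesis
    using p by (simp add: enorm_cmult)
qed

section \<open>Convexity: the inequalities of Jensen, Schur and Minkowski\<close>

lemma real_powr_tangent:
  fixes x s p :: real
  assumes "1 \<le> p" "0 \<le> x" "0 < s"
  shows "p * s powr (p - 1) * x \<le> x powr p + (p - 1) * s powr p"
proof (cases "x = 0")
  case False
  \<comment> \<open>Young's inequality with weights \<open>1 / p\<close> and
    \<open>1 - 1 / p\<close>, applied to p-th powers. Multiplied by \<open>p\<close>, it says that
    the graph of \<open>x powr p\<close> lies above its tangent at \<open>s\<close>.\<close>
  have "(x powr p) powr (1 / p) * (s powr p) powr (1 - 1 / p) \<le> (1 / p) * x powr p + (1 - 1 / p) * s powr p"
    using False assms by (intro Youngs_inequality_0) auto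
  moreover have "p * (1 - 1 / p) = p - 1"
    using assms by (simp add: field_simps)
  ultimately have "x * s powr (p - 1) \<le> (1 / p) * x powr p + (1 - 1 / p) * s powr p"
    using assms by (simp add: powr_powr)
  then have "p * (x * s powr (p - 1)) \<le> p * ((1 / p) * x powr p + (1 - 1 / p) * s powr p)"
    using assms by (intro mult_left_mono) auto
  also have "\<dots> = x powr p + (p - 1) * s powr p"
    using assms by (simp add: field_simps)
  finally show ?thesis
    by (simp add: mult_ac)
qed (use assms in auto)

lemma epow_tangent:
  assumes "1 \<le> p" "0 < s"
  shows "ennreal (p * s powr (p - 1)) * x \<le> epow p x + ennreal ((p - 1) * s powr p)"
proof (cases x)
  case (real r)
  have "ennreal (p * s powr (p - 1)) * x = ennreal (p * s powr (p - 1) * r)"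
    using real assms by (simp add: ennreal_mult')
  also have "\<dots> \<le> ennreal (r powr p + (p - 1) * s powr p)"
    using real_powr_tangent[of p r s] real assms by (intro ennreal_leI) auto
  also have "\<dots> = epow p x + ennreal ((p - 1) * s powr p)"
    using real assms by (simp add: epow_ennreal)
  finally show ?thesis .
qed auto

text \<open>Total mass below one is allowed because the mass multiplies the nonnegative term
  \<open>(p - 1) * s powr p\<close> on the larger side of the averaged tangent inequality and may be
  raised to one there.\<close>

lemma Jensen_epow:
  fixes w x :: "'a \<Rightarrow> ennreal"
  assumes p: "1 \<le> p" and w: "(\<integral>\<^sup>+j. w j \<partial>count_space UNIV) \<le> 1"
  shows "epow p (\<integral>\<^sup>+j. w j * x j \<partial>count_space UNIV) \<le> (\<integral>\<^sup>+j. w j * epow p (x j) \<partial>count_space UNIV)"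
    (is "epow p ?S \<le> ?R")
proof -
  \<comment> \<open>the tangent line of \<open>x powr p\<close> at \<open>s\<close>, averaged; used at the mean \<open>s = ?S\<close>\<close>
  have tangent: "ennreal (p * s powr (p - 1)) * ?S \<le> ?R + ennreal ((p - 1) * s powr p)" if "0 < s" for s
  proof -
    have "ennreal (p * s powr (p - 1)) * ?S
        = (\<integral>\<^sup>+j. w j * (ennreal (p * s powr (p - 1)) * x j) \<partial>count_space UNIV)"
      by (simp add: nn_integral_cmult[symmetric] mult_ac)
    also have "\<dots> \<le> (\<integral>\<^sup>+j. w j * epow p (x j) + ennreal ((p - 1) * s powr p) * w j \<partial>count_space UNIV)"
      using epow_tangent[OF p that]
      by (intro nn_integral_mono) (auto simp: mult.commute[of _ "w _"] simp flip: distrib_left intro!: mult_left_mono)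
    also have "\<dots> = ?R + ennreal ((p - 1) * s powr p) * (\<integral>\<^sup>+j. w j \<partial>count_space UNIV)"
      by (simp add: nn_integral_add nn_integral_cmult)
    also have "\<dots> \<le> ?R + ennreal ((p - 1) * s powr p) * 1"
      by (intro add_left_mono mult_left_mono w) auto
    finally show ?thesis
      by simp
  qed
  show ?thesis
  proof (cases ?S)
    case top
    \<comment> \<open>Any tangent works here: at \<open>s = 1\<close> the slope is positive and the
      constant term finite, so \<open>?R\<close> is infinite.\<close>
    have "top \<le> ?R + ennreal ((p - 1) * 1 powr p)"
      using tangent[of 1] p by (simp add: top ennreal_mult_top del: powr_one_eq_one)
    then show ?thesis
      by (simp add: top_unique)
  next
    case (real S)
    show ?thesis
    proof (cases "S = 0")
      case False
      with real have S: "0 < S" by simp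
      \<comment> \<open>At the mean, the left side of the tangent inequality is
        \<open>S powr p\<close> plus exactly its constant term, which is finite and cancels.\<close>
      have eq: "p * S powr (p - 1) * S = S powr p + (p - 1) * S powr p"
        using S by (simp add: powr_diff field_simps)
      have "ennreal (S powr p) + ennreal ((p - 1) * S powr p) = ennreal (p * S powr (p - 1)) * ennreal S"
        using S p by (simp add: eq flip: ennreal_mult'' ennreal_plus)
      also have "\<dots> \<le> ?R + ennreal ((p - 1) * S powr p)"
        using tangent[OF S] real by simp
      finally have "ennreal (S powr p) \<le> ?R"
        by (simp add: add.commute)
      then show ?thesis
        using S real by (simp add: epow_ennreal)
    qed (use real in simp)
  qed
qed

lemma nn_integral_count_space_swap:
  fixes f :: "'a \<Rightarrow> 'b \<Rightarrow> ennreal"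
  shows "(\<integral>\<^sup>+x. \<integral>\<^sup>+y. f x y \<partial>count_space UNIV \<partial>count_space UNIV)
       = (\<integral>\<^sup>+y. \<integral>\<^sup>+x. f x y \<partial>count_space UNIV \<partial>count_space UNIV)"
  using nn_integral_fst_count_space[of "case_prod f"] nn_integral_snd_count_space[of "case_prod f"]
  by simp

lemma nn_integral_count_space_fibres:
  fixes f :: "'a \<Rightarrow> ennreal" and m :: "'a \<Rightarrow> 'b"
  shows "(\<integral>\<^sup>+x. f x \<partial>count_space UNIV)
       = (\<integral>\<^sup>+n. \<integral>\<^sup>+x. f x * indicator {x. m x = n} x \<partial>count_space UNIV \<partial>count_space UNIV)"
proof -
  have "f x = (\<integral>\<^sup>+n. f x * indicator {x. m x = n} x \<partial>count_space UNIV)" for x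
  proof -
    have "(\<integral>\<^sup>+n. f x * indicator {x. m x = n} x \<partial>count_space UNIV)
        = (\<integral>\<^sup>+n. f x * indicator {m x} n \<partial>count_space UNIV)"
      by (intro nn_integral_cong) (auto split: split_indicator)
    then show ?thesis by simp
  qed
  then show ?thesis
    by (subst nn_integral_count_space_swap) (auto intro: nn_integral_cong)
qed

text \<open>Dividing by \<open>M\<close> turns the rows into weights of mass at most one, so Jensen
  moves the power inside the row sums; after the interchange of sums the column bound removes the
  weights. The supremum norm uses the row bound.\<close>

lemma enorm_Schur:
  fixes b :: "'i \<Rightarrow> 'j \<Rightarrow> ennreal"
  assumes p: "1 \<le> p" and M: "M < top"
    and rows: "\<And>i. (\<integral>\<^sup>+j. b i j \<partial>count_space UNIV) \<le> M"
    and cols: "\<And>j. (\<integral>\<^sup>+i. b i j \<partial>count_space UNIV) \<le> M"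
  shows "enorm p (\<lambda>i. \<integral>\<^sup>+j. b i j * c j \<partial>count_space UNIV) \<le> M * enorm p c"
proof (cases "M = 0")
  case True
  have "b i j = 0" for i j
    using rows[of i] nn_integral_0_iff_AE[of "b i" "count_space UNIV"] by (simp add: True AE_count_space)
  moreover have "enorm p (\<lambda>i :: 'i. 0) = 0"
    by (simp add: enorm_eq_0_iff[OF p])
  ultimately show ?thesis
    by simp
next
  case False
  have inv: "inverse M * M = 1"
    using M False by (simp add: ennreal_divide_times divide_ennreal_def[symmetric] mult.commute
      ennreal_divide_self less_top)
  define w where "w i j = inverse M * b i j" for i j
  have le1: "inverse M * t \<le> 1" if "t \<le> M" for t
    using mult_left_mono[OF that, of "inverse M"] inv by simp
  have w_rows: "(\<integral>\<^sup>+j. w i j \<partial>count_space UNIV) \<le> 1" for i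
    using le1[OF rows] by (simp add: w_def nn_integral_cmult)
  have w_cols: "(\<integral>\<^sup>+i. w i j \<partial>count_space UNIV) \<le> 1" for j
    using le1[OF cols] by (simp add: w_def nn_integral_cmult)
  have b_eq: "b i j = M * w i j" for i j
proof -
    have "M * w i j = inverse M * M * b i j"
      by (simp only: w_def mult_ac)
    then show ?thesis
      by (simp add: inv)
  qed
  have "enorm p (\<lambda>i. \<integral>\<^sup>+j. w i j * c j \<partial>count_space UNIV) \<le> enorm p c"
    using p
  proof (cases rule: ereal_ge_1_cases)
    case (real r)
    have "(\<integral>\<^sup>+i. epow r (\<integral>\<^sup>+j. w i j * c j \<partial>count_space UNIV) \<partial>count_space UNIV)
        \<le> (\<integral>\<^sup>+i. \<integral>\<^sup>+j. w i j * epow r (c j) \<partial>count_space UNIV \<partial>count_space UNIV)"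
      using real by (intro nn_integral_mono Jensen_epow w_rows) auto
    also have "\<dots> = (\<integral>\<^sup>+j. (\<integral>\<^sup>+i. w i j \<partial>count_space UNIV) * epow r (c j) \<partial>count_space UNIV)"
      by (subst nn_integral_count_space_swap) (simp add: nn_integral_multc)
    also have "\<dots> \<le> (\<integral>\<^sup>+j. 1 * epow r (c j) \<partial>count_space UNIV)"
      by (intro nn_integral_mono mult_right_mono w_cols) auto
    finally show ?thesis
      using real by (simp add: enorm_real_le_iff epow_enorm)
  next
    case infinity
    have "(\<integral>\<^sup>+j. w i j * c j \<partial>count_space UNIV) \<le> (\<integral>\<^sup>+j. w i j * enorm p c \<partial>count_space UNIV)" for i
      by (intro nn_integral_mono mult_left_mono le_enorm p) auto
    also have "(\<integral>\<^sup>+j. w i j * enorm p c \<partial>count_space UNIV) \<le> 1 * enorm p c" for i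
      unfolding nn_integral_multc[OF borel_measurable_count_space] by (intro mult_right_mono w_rows) auto
    finally show ?thesis
      by (simp add: infinity enorm_infinity SUP_least)
  qed
  then have "M * enorm p (\<lambda>i. \<integral>\<^sup>+j. w i j * c j \<partial>count_space UNIV) \<le> M * enorm p c"
    by (rule mult_left_mono) simp
  then show ?thesis
    by (simp add: b_eq mult.assoc nn_integral_cmult enorm_cmult[OF p])
qed

text \<open>Jensen takes the place of Hoelder's inequality: with \<open>?T\<close> the sum of the
  norms, \<open>f m\<close> is \<open>?T * w m\<close> times a normalised function
  \<open>x m\<close>, and the weights \<open>w m\<close> have total mass at most one.\<close>

lemma enorm_Minkowski:
  fixes f :: "'m \<Rightarrow> 'i \<Rightarrow> ennreal"
  assumes p: "1 \<le> p"
  shows "enorm p (\<lambda>i. \<integral>\<^sup>+m. f m i \<partial>count_space UNIV) \<le> (\<integral>\<^sup>+m. enorm p (f m) \<partial>count_space UNIV)"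
    (is "?L \<le> ?T")
  using p
proof (cases rule: ereal_ge_1_cases)
  case (real r)
  consider "?T = 0" | "?T = top" | "?T \<noteq> 0" "?T \<noteq> top" by blast
  then show ?thesis
  proof cases
    case 1
    then have "enorm p (f m) = 0" for m
      using nn_integral_0_iff_AE[of "\<lambda>m. enorm p (f m)" "count_space UNIV"] by (simp add: AE_count_space)
    then have "f m i = 0" for m i
      by (simp add: enorm_eq_0_iff[OF p])
    moreover have "enorm p (\<lambda>i :: 'i. 0) = 0"
      by (simp add: enorm_eq_0_iff[OF p])
    ultimately show ?thesis
      by simp
  next
    case 3
    have fin: "enorm p (f m) < top" for m
    proof -
      have "enorm p (f m) \<le> ?T"
        by (rule le_nn_integral_count_space)
      then show ?thesis
        using 3 by (meson order_le_less_trans top.not_eq_extremum)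
    qed
    define w where "w m = inverse ?T * enorm p (f m)" for m
    define x where "x m i = inverse (enorm p (f m)) * f m i" for m i
    have inv: "t * inverse t = 1" if "t \<noteq> 0" "t < top" for t :: ennreal
      using that by (simp add: divide_ennreal_def[symmetric])
    have invT: "inverse ?T * ?T = 1"
      using 3 inv[of ?T] by (simp add: mult.commute top.not_eq_extremum)
    have w: "(\<integral>\<^sup>+m. w m \<partial>count_space UNIV) \<le> 1"
      by (simp add: w_def nn_integral_cmult invT)
    \<comment> \<open>If \<open>f m\<close> has norm zero it vanishes identically, and
      \<open>inverse 0 * 0 = top * 0 = 0\<close> makes both sides zero.\<close>
    have wx: "?T * (w m * x m i) = f m i" for m i
    proof (cases "enorm p (f m) = 0")
      case True
      then show ?thesis
        by (simp add: w_def enorm_eq_0_iff[OF p] x_def)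
    next
      case False
      have "?T * (w m * x m i) = (inverse ?T * ?T) * (enorm p (f m) * inverse (enorm p (f m))) * f m i"
        by (simp only: w_def x_def mult_ac)
      then show ?thesis
        using inv[OF False fin] invT by simp
    qed
    have x1: "(\<integral>\<^sup>+i. epow r (x m i) \<partial>count_space UNIV) \<le> 1" for m
    proof -
      have "enorm p (x m) = inverse (enorm p (f m)) * enorm p (f m)"
        unfolding x_def by (rule enorm_cmult[OF p])
      also have "\<dots> \<le> 1"
        using inv[OF _ fin, of m] by (cases "enorm p (f m) = 0") (auto simp: mult.commute)
      finally show ?thesis
        using real by (simp add: enorm_real_le_iff)
    qed
    have "(\<integral>\<^sup>+i. epow r (\<integral>\<^sup>+m. w m * x m i \<partial>count_space UNIV) \<partial>count_space UNIV)
        \<le> (\<integral>\<^sup>+i. \<integral>\<^sup>+m. w m * epow r (x m i) \<partial>count_space UNIV \<partial>count_space UNIV)"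
      using real by (intro nn_integral_mono Jensen_epow w) auto
    also have "\<dots> = (\<integral>\<^sup>+m. w m * (\<integral>\<^sup>+i. epow r (x m i) \<partial>count_space UNIV) \<partial>count_space UNIV)"
      by (subst nn_integral_count_space_swap) (simp add: nn_integral_cmult)
    also have "\<dots> \<le> (\<integral>\<^sup>+m. w m * 1 \<partial>count_space UNIV)"
      by (intro nn_integral_mono mult_left_mono x1) auto
    also have "\<dots> \<le> 1"
      using w by simp
    finally have "enorm p (\<lambda>i. \<integral>\<^sup>+m. w m * x m i \<partial>count_space UNIV) \<le> 1"
      using real by (simp add: enorm_real_le_iff)
    then have "?T * enorm p (\<lambda>i. \<integral>\<^sup>+m. w m * x m i \<partial>count_space UNIV) \<le> ?T"
      using mult_left_mono[of _ 1 ?T] by simp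
    then show ?thesis
      by (simp add: wx enorm_cmult[OF p, symmetric] nn_integral_cmult[symmetric])
  qed simp
next
  case infinity
  have "(\<integral>\<^sup>+m. f m i \<partial>count_space UNIV) \<le> ?T" for i
    by (intro nn_integral_mono le_enorm p)
  then show ?thesis
    by (simp add: infinity enorm_infinity SUP_least)
qed

lemma enorm_triangle:
  assumes p: "1 \<le> p"
  shows "enorm p (\<lambda>i. f i + g i) \<le> enorm p f + enorm p g"
  using enorm_Minkowski[OF p, of "case_bool f g"]
  by (simp add: nn_integral_count_space_finite UNIV_bool add.commute)

text \<open>A function is the sum of its one-point pieces, whose norms equal its values in every
  exponent; Minkowski's inequality does the rest.\<close>

lemma enorm_le_nn_integral:
  assumes p: "1 \<le> p"
  shows "enorm p f \<le> (\<integral>\<^sup>+x. f x \<partial>count_space UNIV)"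
proof -
  have "f = (\<lambda>x. \<integral>\<^sup>+y. f y * indicator {y} x \<partial>count_space UNIV)"
  proof
    fix x
    have "(\<integral>\<^sup>+y. f y * indicator {y} x \<partial>count_space UNIV) = (\<integral>\<^sup>+y. f y * indicator {x} y \<partial>count_space UNIV)"
      by (intro nn_integral_cong) (auto split: split_indicator)
    then show "f x = (\<integral>\<^sup>+y. f y * indicator {y} x \<partial>count_space UNIV)" by simp
  qed
  then have "enorm p f \<le> (\<integral>\<^sup>+y. enorm p (\<lambda>x. f y * indicator {y} x) \<partial>count_space UNIV)"
    using enorm_Minkowski[OF p, of "\<lambda>y x. f y * indicator {y} x"] by simp
  then show ?thesis
    by (simp add: enorm_indicator_singleton[OF p])
qed

text \<open>The local exchange of exponents: the l^q norm is at most the l^1 norm, which has at most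
  \<open>D\<close> nonzero terms, each bounded by the l^p norm.\<close>

lemma enorm_le_enorm_of_support:
  assumes p: "1 \<le> p" and q: "1 \<le> q"
    and supp: "\<And>x. x \<notin> F \<Longrightarrow> f x = 0"
    and D: "(\<integral>\<^sup>+x. indicator F x \<partial>count_space UNIV) \<le> D"
  shows "enorm q f \<le> D * enorm p f"
proof -
  have "enorm q f \<le> (\<integral>\<^sup>+x. f x \<partial>count_space UNIV)"
    by (rule enorm_le_nn_integral[OF q])
  also have "\<dots> \<le> (\<integral>\<^sup>+x. indicator F x * enorm p f \<partial>count_space UNIV)"
    using supp by (intro nn_integral_mono) (auto intro: le_enorm[OF p] split: split_indicator)
  also have "\<dots> \<le> D * enorm p f"
    unfolding nn_integral_multc[OF borel_measurable_count_space] by (intro mult_right_mono D) auto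
  finally show ?thesis .
qed

lemma enorm_fibres:
  fixes m :: "'a \<Rightarrow> 'b"
  assumes p: "1 \<le> p"
  shows "enorm p (\<lambda>n. enorm p (\<lambda>x. f x * indicator {x. m x = n} x)) = enorm p f"
  using p
proof (cases rule: ereal_ge_1_cases)
  case (real r)
  have "epow r (f x * indicator {x. m x = n} x) = epow r (f x) * indicator {x. m x = n} x" for x n
    by (auto split: split_indicator)
  then show ?thesis
    using real nn_integral_count_space_fibres[of "\<lambda>x. epow r (f x)" m]
    by (simp add: enorm_real epow_epow_inverse)
next
  case infinity
  have "(SUP n. SUP x. f x * indicator {x. m x = n} x) = (SUP x. f x)"
  proof (rule antisym)
    show "(SUP x. f x) \<le> (SUP n. SUP x. f x * indicator {x. m x = n} x)"
    proof (rule SUP_least)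
      fix x
      show "f x \<le> (SUP n. SUP x. f x * indicator {x. m x = n} x)"
        by (rule SUP_upper2[of "m x"], simp, rule SUP_upper2[of x]) auto
    qed
  qed (auto intro!: SUP_least SUP_upper2 split: split_indicator)
  then show ?thesis
    by (simp add: infinity enorm_infinity)
qed

subsection \<open>Sequence spaces and sums of extended nonnegative reals\<close>

lemma summable_on_iff_nn_integral:
  fixes g :: "'a \<Rightarrow> real"
  assumes nonneg: "\<And>x. 0 \<le> g x"
  shows "g summable_on A \<longleftrightarrow> (\<integral>\<^sup>+x. ennreal (g x) \<partial>count_space A) < top"
proof -
  have "g summable_on A \<longleftrightarrow> (\<lambda>x. norm (g x)) summable_on A"
    using nonneg by simp
  also have "\<dots> \<longleftrightarrow> Infinite_Set_Sum.abs_summable_on g A"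
    by (rule abs_summable_equivalent)
  also have "\<dots> \<longleftrightarrow> (\<integral>\<^sup>+x. ennreal (g x) \<partial>count_space A) < top"
    using nonneg by (simp add: abs_summable_on_def integrable_iff_bounded)
  finally show ?thesis .
qed

lemma nn_integral_eq_infsum_real:
  fixes g :: "'a \<Rightarrow> real"
  assumes nonneg: "\<And>x. 0 \<le> g x" and sum: "g summable_on A"
  shows "(\<integral>\<^sup>+x. ennreal (g x) \<partial>count_space A) = ennreal (infsum g A)"
proof -
  have abs: "Infinite_Set_Sum.abs_summable_on g A"
    using assms by (simp flip: abs_summable_equivalent)
  show ?thesis
    using nn_integral_conv_infsetsum[OF abs] nonneg by (simp add: infsetsum_infsum[OF abs])
qed

lemma sum_le_infsum_ennreal:
  fixes f :: "'a \<Rightarrow> ennreal"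
  shows "F \<subseteq> A \<Longrightarrow> finite F \<Longrightarrow> sum f F \<le> infsum f A"
  by (subst nonneg_infsum_complete) (auto intro: SUP_upper)

text \<open>Links the sums in the definitions to integrals against counting measure, the form used
  in all estimates. An infinite value makes both sides \<open>top\<close>; otherwise both reduce to
  real sums.\<close>

lemma nn_integral_eq_infsum_ennreal:
  fixes f :: "'a \<Rightarrow> ennreal"
  shows "(\<integral>\<^sup>+x. f x \<partial>count_space A) = infsum f A"
proof (cases "\<exists>x\<in>A. f x = top")
  case True
  then obtain x where x: "x \<in> A" "f x = top" by auto
  have "f x \<le> infsum f A"
    using sum_le_infsum_ennreal[of "{x}" A f] x by simp
  moreover have "(\<integral>\<^sup>+y. f x * indicator {x} y \<partial>count_space A) \<le> (\<integral>\<^sup>+y. f y \<partial>count_space A)"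
    by (intro nn_integral_mono) (auto split: split_indicator)
  ultimately show ?thesis
    using x by (simp add: top_unique)
next
  case False
  define g where "g x = enn2real (f x)" for x
  have g: "ennreal (g x) = f x" if "x \<in> A" for x
    using False that by (auto simp: g_def less_top)
  have nn: "(\<integral>\<^sup>+x. f x \<partial>count_space A) = (\<integral>\<^sup>+x. ennreal (g x) \<partial>count_space A)"
    using g by (intro nn_integral_cong) auto
  have inf: "infsum f A = infsum (ennreal \<circ> g) A"
    using g by (intro infsum_cong) auto
  show ?thesis
  proof (cases "g summable_on A")
    case True
    have "infsum (ennreal \<circ> g) A = ennreal (infsum g A)"
      using True by (intro infsum_comm_additive_general) (auto simp: g_def)
    then show ?thesis
      using True nn_integral_eq_infsum_real[of g A] by (simp add: nn inf g_def)
  next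
    case nsum: False
    \<comment> \<open>A finite sum in \<open>ennreal\<close> would bound all finite partial sums of
      the nonnegative \<open>g\<close> and so make it summable.\<close>
    have "infsum (ennreal \<circ> g) A = top"
    proof (rule ccontr)
      assume fin: "infsum (ennreal \<circ> g) A \<noteq> top"
      have "sum g F \<le> enn2real (infsum (ennreal \<circ> g) A)" if "F \<subseteq> A" "finite F" for F
      proof -
        have "ennreal (sum g F) = sum (ennreal \<circ> g) F"
          by (simp add: g_def)
        also have "\<dots> \<le> infsum (ennreal \<circ> g) A"
          using that by (intro sum_le_infsum_ennreal)
        finally have "enn2real (ennreal (sum g F)) \<le> enn2real (infsum (ennreal \<circ> g) A)"
          using fin by (intro enn2real_mono) (auto simp: less_top)
        then show ?thesis
          by (simp add: g_def sum_nonneg)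
      qed
      then have "g summable_on A"
        by (intro nonneg_bdd_above_summable_on bdd_aboveI2) (auto simp: g_def)
      with nsum show False ..
    qed
    moreover have "(\<integral>\<^sup>+x. ennreal (g x) \<partial>count_space A) = top"
      using nsum summable_on_iff_nn_integral[of g A] by (metis enn2real_nonneg g_def top.not_eq_extremum)
    ultimately show ?thesis
      by (simp add: nn inf)
  qed
qed

text \<open>
  Extending sequences by zero lets all sums range over the whole type, where they can be
  interchanged freely.
\<close>

definition abs_ext :: "'a set \<Rightarrow> ('a \<Rightarrow> complex) \<Rightarrow> 'a \<Rightarrow> ennreal" where
  "abs_ext S c x = (if x \<in> S then ennreal (norm (c x)) else 0)"

lemma nn_integral_abs_ext_powr:
  "(\<integral>\<^sup>+x. epow r (abs_ext S c x) \<partial>count_space UNIV)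
     = (\<integral>\<^sup>+x. ennreal (norm (c x) powr r) \<partial>count_space S)"
proof -
  have "epow r (abs_ext S c x) = ennreal (norm (c x) powr r) * indicator S x" for x
    by (auto simp: abs_ext_def epow_ennreal)
  then show ?thesis
    by (simp add: nn_integral_count_space_indicator)
qed

lemma ell_space_iff:
  assumes p: "1 \<le> p"
  shows "c \<in> ell_space p S \<longleftrightarrow> enorm p (abs_ext S c) < top"
  using p
proof (cases rule: ereal_ge_1_cases)
  case (real r)
  then show ?thesis
    using epow_eq_top_iff
    by (simp add: ell_space_def enorm_real nn_integral_abs_ext_powr summable_on_iff_nn_integral top.not_eq_extremum[symmetric])
next
  case infinity
  have "bdd_above ((\<lambda>x. norm (c x)) ` S)" if fin: "(SUP x. abs_ext S c x) < top"
  proof (rule bdd_aboveI2)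
    fix x assume "x \<in> S"
    then have "ennreal (norm (c x)) \<le> (SUP x. abs_ext S c x)"
      by (intro SUP_upper2[of x]) (auto simp: abs_ext_def)
    then have "enn2real (ennreal (norm (c x))) \<le> enn2real (SUP x. abs_ext S c x)"
      using fin by (rule enn2real_mono)
    then show "norm (c x) \<le> enn2real (SUP x. abs_ext S c x)"
      by simp
  qed
  moreover have "(SUP x. abs_ext S c x) < top" if "bdd_above ((\<lambda>x. norm (c x)) ` S)"
  proof -
    obtain B where B: "\<And>x. x \<in> S \<Longrightarrow> norm (c x) \<le> B"
      using \<open>bdd_above _\<close> by (auto simp: bdd_above_def)
    have "(SUP x. abs_ext S c x) \<le> ennreal B"
      by (rule SUP_least) (auto simp: abs_ext_def intro: ennreal_leI B)
    then show ?thesis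
      by (rule order_le_less_trans) simp
  qed
  ultimately show ?thesis
    using infinity by (auto simp: ell_space_def enorm_infinity)
qed

lemma ennreal_ell_norm:
  assumes p: "1 \<le> p" and c: "c \<in> ell_space p S"
  shows "ennreal (ell_norm p S c) = enorm p (abs_ext S c)"
  using p
proof (cases rule: ereal_ge_1_cases)
  case (real r)
  have "(\<lambda>x. norm (c x) powr r) summable_on S"
    using c real by (simp add: ell_space_def)
  then show ?thesis
    using real by (simp add: ell_norm_def enorm_real nn_integral_abs_ext_powr nn_integral_eq_infsum_real
      epow_ennreal infsum_nonneg)
next
  case infinity
  let ?A = "insert 0 ((\<lambda>x. norm (c x)) ` S)"
  have bdd: "bdd_above ?A"
    using c infinity by (simp add: ell_space_def)
  have "(SUP x. abs_ext S c x) < top"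
    using c ell_space_iff[OF p, of c S] infinity by (simp add: enorm_infinity)
  then have fin: "ennreal (enn2real (SUP x. abs_ext S c x)) = (SUP x. abs_ext S c x)"
    by simp
  have "Sup ?A \<le> enn2real (SUP x. abs_ext S c x)"
  proof (rule cSup_least)
    fix t assume "t \<in> ?A"
    then consider "t = 0" | x where "x \<in> S" "t = norm (c x)" by auto
    then show "t \<le> enn2real (SUP x. abs_ext S c x)"
    proof cases
      case 2
      then have "ennreal t \<le> (SUP x. abs_ext S c x)"
        by (intro SUP_upper2[of x]) (auto simp: abs_ext_def)
      then show ?thesis
        using enn2real_mono[of "ennreal t" "SUP x. abs_ext S c x"] \<open>_ < top\<close> 2 by simp
    qed simp
  qed simp
  then have "ennreal (Sup ?A) \<le> (SUP x. abs_ext S c x)"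
    using ennreal_leI fin by metis
  moreover have "abs_ext S c x \<le> ennreal (Sup ?A)" for x
    using bdd by (auto simp: abs_ext_def intro!: ennreal_leI cSup_upper)
  ultimately show ?thesis
    using infinity by (simp add: ell_norm_def enorm_infinity antisym SUP_least)
qed

lemma ell_norm_nonneg:
  assumes "c \<in> ell_space p S"
  shows "0 \<le> ell_norm p S c"
proof (cases "p = \<infinity>")
  case True
  then show ?thesis
    using assms by (auto simp: ell_norm_def ell_space_def intro!: cSup_upper)
qed (simp add: ell_norm_def)

text \<open>Moves stability into the extended nonnegative reals, with the inverse constant cleared
  from the lower bound.\<close>

lemma ell_stable_iff:
  assumes p: "1 \<le> p"
  shows "ell_stable p S T a \<longleftrightarrow> (\<exists>C>0. \<forall>c. enorm p (abs_ext T c) < top \<longrightarrow>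
     enorm p (abs_ext S (mat_apply T a c)) < top \<and>
     enorm p (abs_ext T c) \<le> ennreal C * enorm p (abs_ext S (mat_apply T a c)) \<and>
     enorm p (abs_ext S (mat_apply T a c)) \<le> ennreal C * enorm p (abs_ext T c))"
proof -
  have "inverse C * ell_norm p T c \<le> ell_norm p S d \<longleftrightarrow>
      enorm p (abs_ext T c) \<le> ennreal C * enorm p (abs_ext S d)"
    "ell_norm p S d \<le> C * ell_norm p T c \<longleftrightarrow>
      enorm p (abs_ext S d) \<le> ennreal C * enorm p (abs_ext T c)"
    if "0 < C" "c \<in> ell_space p T" "d \<in> ell_space p S" for C c d
    using that ell_norm_nonneg[OF that(2)] ell_norm_nonneg[OF that(3)]
    by (simp_all add: ennreal_ell_norm[OF p, symmetric] field_simps flip: ennreal_mult)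
  then show ?thesis
    unfolding ell_stable_def Ball_def ell_space_iff[OF p]
    by (intro ex_cong1 conj_cong refl all_cong1 imp_cong) auto
qed

lemma summable_on_of_nn_integral_abs_ext:
  assumes "(\<integral>\<^sup>+x. abs_ext S f x \<partial>count_space UNIV) < top"
  shows "f summable_on S"
    and "ennreal (norm (infsum f S)) \<le> (\<integral>\<^sup>+x. abs_ext S f x \<partial>count_space UNIV)"
proof -
  have eq: "(\<integral>\<^sup>+x. abs_ext S f x \<partial>count_space UNIV) = (\<integral>\<^sup>+x. ennreal (norm (f x)) \<partial>count_space S)"
    using nn_integral_abs_ext_powr[of 1 S f] by simp
  with assms have "(\<lambda>x. norm (f x)) summable_on S"
    by (subst summable_on_iff_nn_integral) auto
  then show "f summable_on S" "ennreal (norm (infsum f S)) \<le> (\<integral>\<^sup>+x. abs_ext S f x \<partial>count_space UNIV)"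
    by (auto simp: eq nn_integral_eq_infsum_real abs_summable_summable norm_infsum_bound intro!: ennreal_leI)
qed

text \<open>Group the points of \<open>S\<close> by the value of \<open>t\<close>; each value occurs
  at most \<open>K\<close> times.\<close>

lemma nn_integral_comp_le:
  fixes t :: "'a \<Rightarrow> 'k" and \<phi> :: "'k \<Rightarrow> ennreal"
  assumes K: "\<And>k. (\<integral>\<^sup>+x. indicator {x \<in> S. t x = k} x \<partial>count_space UNIV) \<le> K"
  shows "(\<integral>\<^sup>+x. indicator S x * \<phi> (t x) \<partial>count_space UNIV) \<le> K * (\<integral>\<^sup>+k. \<phi> k \<partial>count_space UNIV)"
proof -
  have "(\<integral>\<^sup>+x. indicator S x * \<phi> (t x) \<partial>count_space UNIV)
      = (\<integral>\<^sup>+k. \<integral>\<^sup>+x. indicator {x \<in> S. t x = k} x * \<phi> k \<partial>count_space UNIV \<partial>count_space UNIV)"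
    by (subst nn_integral_count_space_fibres[of _ t]) (auto intro!: nn_integral_cong split: split_indicator)
  also have "\<dots> \<le> (\<integral>\<^sup>+k. K * \<phi> k \<partial>count_space UNIV)"
  proof (intro nn_integral_mono)
    fix k
    show "(\<integral>\<^sup>+x. indicator {x \<in> S. t x = k} x * \<phi> k \<partial>count_space UNIV) \<le> K * \<phi> k"
      by (subst nn_integral_multc, simp, intro mult_right_mono K, simp)
  qed
  finally show ?thesis
    by (simp add: nn_integral_cmult)
qed

text \<open>Union bound, where the integral of an indicator serves as a cardinality with values in
  \<open>ennreal\<close>.\<close>

lemma nn_integral_indicator_cover:
  assumes "finite E" and cover: "\<And>x. x \<in> S \<Longrightarrow> \<exists>e\<in>E. x \<in> T e"
    and K: "\<And>e. e \<in> E \<Longrightarrow> (\<integral>\<^sup>+x. indicator (T e) x \<partial>count_space UNIV) \<le> K"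
  shows "(\<integral>\<^sup>+x. indicator S x \<partial>count_space UNIV) \<le> of_nat (card E) * K"
proof -
  have "(\<integral>\<^sup>+x. indicator S x \<partial>count_space UNIV) \<le> (\<integral>\<^sup>+x. (\<Sum>e\<in>E. indicator (T e) x) \<partial>count_space UNIV)"
  proof (intro nn_integral_mono)
    fix x
    show "indicator S x \<le> (\<Sum>e\<in>E. indicator (T e) x :: ennreal)"
    proof (cases "x \<in> S")
      case True
      then obtain e where e: "e \<in> E" "x \<in> T e" using cover by auto
      then show ?thesis
        using member_le_sum[of e E "\<lambda>e. indicator (T e) x :: ennreal"] \<open>finite E\<close> True by simp
    qed simp
  qed
  also have "\<dots> = (\<Sum>e\<in>E. \<integral>\<^sup>+x. indicator (T e) x \<partial>count_space UNIV)"
    by (rule nn_integral_sum) auto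
  also have "\<dots> \<le> (\<Sum>e\<in>E. K)"
    by (intro sum_mono K)
  finally show ?thesis by simp
qed

subsection \<open>Counting points of relatively separated sets\<close>

definition floor_vec :: "real ^ 'n \<Rightarrow> int ^ 'n" where
  "floor_vec x = (\<chi> i. \<lfloor>x $ i\<rfloor>)"

lemma floor_vec_nth [simp]: "floor_vec x $ i = \<lfloor>x $ i\<rfloor>"
  by (simp add: floor_vec_def)

lemma int_vec_nth [simp]: "int_vec k $ i = of_int (k $ i)"
  by (simp add: int_vec_def)

lemma mem_translate_unit_cube: "x \<in> (+) y ` unit_cube \<longleftrightarrow> floor_vec (x - y) = 0"
proof -
  have "x \<in> (+) y ` unit_cube \<longleftrightarrow> x - y \<in> unit_cube"
    by (auto intro!: image_eqI[of _ _ "x - y"])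
  also have "\<dots> \<longleftrightarrow> floor_vec (x - y) = 0"
    by (simp add: unit_cube_def vec_eq_iff floor_eq_iff)
  finally show ?thesis .
qed

lemma floor_vec_diff_int_vec: "floor_vec (x - int_vec k) = floor_vec x - k"
  by (simp add: vec_eq_iff)

definition int_box :: "int \<Rightarrow> (int ^ 'n) set" where
  "int_box r = {j. \<forall>i. \<bar>j $ i\<bar> \<le> r}"

lemma finite_int_box [simp]: "finite (int_box r :: (int ^ 'n) set)"
proof -
  have "(int_box r :: (int ^ 'n) set) \<subseteq> vec_lambda ` (PiE UNIV (\<lambda>_. {-r..r}))"
  proof
    fix j :: "int ^ 'n" assume "j \<in> int_box r"
    then have "vec_nth j \<in> PiE UNIV (\<lambda>_. {-r..r})"
      by (auto simp: int_box_def abs_le_iff minus_le_iff)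
    then show "j \<in> vec_lambda ` (PiE UNIV (\<lambda>_. {-r..r}))"
      by (intro image_eqI[of _ _ "vec_nth j"]) auto
  qed
  then show ?thesis
    by (rule finite_subset) (auto intro!: finite_imageI finite_PiE)
qed

text \<open>Both orders of subtraction occur later: \<open>x - \<mu>\<close> when summing along rows
  of the matrix, \<open>\<mu> - x\<close> when summing along columns and when counting points in
  blocks.\<close>

lemma relatively_separated_count:
  fixes \<Lambda> :: "(real ^ 'n) set"
  assumes "relatively_separated \<Lambda>"
  obtains K where "K < top"
    "\<And>x k. (\<integral>\<^sup>+\<mu>. indicator {\<mu> \<in> \<Lambda>. floor_vec (x - \<mu>) = k} \<mu> \<partial>count_space UNIV) \<le> K"
    "\<And>x k. (\<integral>\<^sup>+\<mu>. indicator {\<mu> \<in> \<Lambda>. floor_vec (\<mu> - x) = k} \<mu> \<partial>count_space UNIV) \<le> K"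
proof -
  define R where "R = separation_bound \<Lambda>"
  define K where "K = of_nat (card (int_box 1 :: (int ^ 'n) set)) * R"
  have R: "R < top"
    using assms by (simp add: R_def relatively_separated_def)
  have below: "(\<integral>\<^sup>+\<mu>. indicator {\<mu> \<in> \<Lambda>. floor_vec (x - \<mu>) = k} \<mu> \<partial>count_space UNIV) \<le> R" for x k
  proof -
    \<comment> \<open>Moving the base point by \<open>int_vec k\<close> reduces to
      \<open>k = 0\<close>, the case counted by \<open>separation_bound\<close>.\<close>
    have "floor_vec (x - int_vec k - \<mu>) = floor_vec (x - \<mu>) - k" for \<mu>
      using floor_vec_diff_int_vec[of "x - \<mu>" k] by (simp add: algebra_simps)
    then have "(\<integral>\<^sup>+\<mu>. indicator {\<mu> \<in> \<Lambda>. floor_vec (x - \<mu>) = k} \<mu> \<partial>count_space UNIV)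
        = (\<integral>\<^sup>+\<mu>. indicator ((+) \<mu> ` unit_cube) (x - int_vec k) * indicator \<Lambda> \<mu> \<partial>count_space UNIV)"
      by (intro nn_integral_cong) (auto simp: indicator_def mem_translate_unit_cube)
    also have "\<dots> = (\<Sum>\<^sub>\<infinity>\<mu>\<in>\<Lambda>. indicator ((+) \<mu> ` unit_cube) (x - int_vec k))"
      by (simp add: nn_integral_eq_infsum_ennreal[symmetric] nn_integral_count_space_indicator)
    also have "\<dots> \<le> R"
      unfolding R_def separation_bound_def by (rule SUP_upper) simp
    finally show ?thesis .
  qed
  have above: "(\<integral>\<^sup>+\<mu>. indicator {\<mu> \<in> \<Lambda>. floor_vec (\<mu> - x) = k} \<mu> \<partial>count_space UNIV) \<le> K" for x k
    unfolding K_def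
  proof (rule nn_integral_indicator_cover)
    fix \<mu> assume \<mu>: "\<mu> \<in> {\<mu> \<in> \<Lambda>. floor_vec (\<mu> - x) = k}"
    \<comment> \<open>The floors of \<open>t\<close> and \<open>- t\<close> add up to 0 or -1, so
      reversing the difference costs a cover by boundedly many cubes.\<close>
    define e where "e = floor_vec (x - \<mu>) + k"
    have "\<bar>e $ i\<bar> \<le> 1" for i
    proof -
      have "k $ i = \<lfloor>\<mu> $ i - x $ i\<rfloor>"
        using \<mu> by auto
      then show ?thesis
        unfolding e_def by simp linarith
    qed
    then have "e \<in> int_box 1" "\<mu> \<in> {\<mu> \<in> \<Lambda>. floor_vec (x - \<mu>) = e - k}"
      using \<mu> by (auto simp: int_box_def e_def)
    then show "\<exists>e\<in>int_box 1. \<mu> \<in> {\<mu> \<in> \<Lambda>. floor_vec (x - \<mu>) = e - k}" ..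
  qed (simp, rule below)
  show ?thesis
  proof (rule that)
    show "max R K < top"
      using R by (simp add: K_def ennreal_mult_less_top of_nat_less_top)
  qed (rule order_trans[OF below] order_trans[OF above], simp)+
qed

subsection \<open>Blocks and windows\<close>

definition block :: "nat \<Rightarrow> real ^ 'n \<Rightarrow> int ^ 'n" where
  "block N x = (\<chi> i. \<lfloor>x $ i / real N\<rfloor>)"

text \<open>
  The height \<open>CARD('n) + 1\<close> exceeds the Euclidean diameter of a unit cube by at least one, so that the
  window is at least one on its block.
\<close>

definition window :: "nat \<Rightarrow> int ^ 'n \<Rightarrow> real ^ 'n \<Rightarrow> real" where
  "window N n x = max 0 (real CARD('n) + 1 - norm (inverse (real N) *\<^sub>R x - int_vec n))"

text \<open>A bound for the variation of a window between two points whose difference has floor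
  \<open>k\<close>: the Lipschitz bound, with \<open>+ 1\<close> for the fractional part of each
  coordinate, capped by the height of the window. The cap makes it bounded uniformly in
  \<open>N\<close> and \<open>k\<close>.\<close>

definition window_modulus :: "nat \<Rightarrow> int ^ 'n \<Rightarrow> real" where
  "window_modulus N k = min (real CARD('n) + 1) ((\<Sum>i\<in>UNIV. \<bar>of_int (k $ i)\<bar> + 1) / real N)"

lemma block_nth [simp]: "block N x $ i = \<lfloor>x $ i / real N\<rfloor>"
  by (simp add: block_def)

lemma window_nonneg: "0 \<le> window N n x"
  by (simp add: window_def)

lemma window_le: "window N n (x :: real ^ 'n) \<le> real CARD('n) + 1"
  by (simp add: window_def)

lemma window_block_ge_1:
  fixes x :: "real ^ 'n"
  shows "1 \<le> window N (block N x) x"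
proof -
  have "norm (inverse (real N) *\<^sub>R x - int_vec (block N x))
      \<le> (\<Sum>i\<in>UNIV. \<bar>(inverse (real N) *\<^sub>R x - int_vec (block N x)) $ i\<bar>)"
    by (rule norm_le_l1_cart)
  also have "\<dots> \<le> (\<Sum>i\<in>(UNIV :: 'n set). 1)"
  proof (rule sum_mono)
    fix i
    have "(inverse (real N) *\<^sub>R x - int_vec (block N x)) $ i = x $ i / real N - of_int \<lfloor>x $ i / real N\<rfloor>"
      by (simp add: divide_inverse mult.commute)
    then show "\<bar>(inverse (real N) *\<^sub>R x - int_vec (block N x)) $ i\<bar> \<le> 1"
      by linarith
  qed
  finally show ?thesis
    by (simp add: window_def)
qed

text \<open>Each coordinate of \<open>x / N\<close> is within \<open>CARD('n) + 1\<close> of that of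
  \<open>n\<close>, and taking its floor costs less than one more.\<close>

lemma window_support:
  fixes x :: "real ^ 'n"
  assumes "window N n x \<noteq> 0"
  shows "n - block N x \<in> int_box (int CARD('n) + 2)"
proof -
  have "\<bar>(n - block N x) $ i\<bar> \<le> int CARD('n) + 2" for i
  proof -
    have "\<bar>(inverse (real N) *\<^sub>R x - int_vec n) $ i\<bar> \<le> norm (inverse (real N) *\<^sub>R x - int_vec n)"
      by (rule component_le_norm_cart)
    also have "\<dots> < real CARD('n) + 1"
      using assms by (simp add: window_def max_def split: if_splits)
    finally have "\<bar>x $ i / real N - of_int (n $ i)\<bar> < real CARD('n) + 1"
      by (simp add: divide_inverse mult.commute)
    then show ?thesis
      by simp linarith
  qed
  then show ?thesis
    by (simp add: int_box_def)
qed

lemma int_box_mono: "r \<le> s \<Longrightarrow> int_box r \<subseteq> int_box s"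
  by (auto simp: int_box_def intro: order_trans)

lemma norm_le_floor_vec:
  fixes x :: "real ^ 'n"
  shows "norm x \<le> (\<Sum>i\<in>UNIV. \<bar>of_int (floor_vec x $ i)\<bar> + 1)"
proof -
  have "norm x \<le> (\<Sum>i\<in>UNIV. \<bar>x $ i\<bar>)"
    by (rule norm_le_l1_cart)
  also have "\<dots> \<le> (\<Sum>i\<in>UNIV. \<bar>of_int (floor_vec x $ i)\<bar> + 1)"
    by (intro sum_mono) (simp, linarith)
  finally show ?thesis .
qed

text \<open>Truncation at zero and the norm are both 1-Lipschitz, so rescaling by \<open>N\<close>
  gives the constant \<open>1 / N\<close>.\<close>

lemma window_diff_le:
  fixes x y :: "real ^ 'n"
  shows "\<bar>window N n x - window N n y\<bar> \<le> window_modulus N (floor_vec (x - y))"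
proof -
  let ?u = "inverse (real N) *\<^sub>R x - int_vec n" and ?v = "inverse (real N) *\<^sub>R y - int_vec n"
  have "\<bar>window N n x - window N n y\<bar> \<le> \<bar>norm ?u - norm ?v\<bar>"
    by (simp add: window_def max_def abs_minus_commute)
  also have "\<dots> \<le> norm (?u - ?v)"
    by (rule norm_triangle_ineq3)
  also have "\<dots> = norm (x - y) / real N"
    by (simp add: divide_inverse mult.commute flip: scaleR_diff_right)
  also have "\<dots> \<le> (\<Sum>i\<in>UNIV. \<bar>of_int (floor_vec (x - y) $ i)\<bar> + 1) / real N"
    by (intro divide_right_mono norm_le_floor_vec) simp
  finally have "\<bar>window N n x - window N n y\<bar> \<le> (\<Sum>i\<in>UNIV. \<bar>of_int (floor_vec (x - y) $ i)\<bar> + 1) / real N" .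
  moreover have "\<bar>window N n x - window N n y\<bar> \<le> real CARD('n) + 1"
    using window_nonneg[of N n x] window_nonneg[of N n y] window_le[of N n x] window_le[of N n y] by linarith
  ultimately show ?thesis
    by (simp add: window_modulus_def)
qed

lemma window_modulus_le: "window_modulus N (k :: int ^ 'n) \<le> real CARD('n) + 1"
  by (simp add: window_modulus_def)

text \<open>The cap in \<open>window_modulus\<close> supplies a summable majorant independent of
  \<open>N\<close>, while for each fixed \<open>k\<close> the modulus tends to zero.\<close>

lemma nn_integral_window_modulus_tendsto_0:
  fixes \<alpha> :: "int ^ 'n \<Rightarrow> ennreal"
  assumes \<alpha>: "(\<integral>\<^sup>+k. \<alpha> k \<partial>count_space UNIV) < top"
  shows "(\<lambda>N. \<integral>\<^sup>+k. \<alpha> k * ennreal (window_modulus N k) \<partial>count_space UNIV) \<longlonglongrightarrow> 0"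
proof -
  have "(\<lambda>N. \<integral>\<^sup>+k. \<alpha> k * ennreal (window_modulus N k) \<partial>count_space UNIV)
      \<longlonglongrightarrow> (\<integral>\<^sup>+k. 0 \<partial>count_space (UNIV :: (int ^ 'n) set))"
  proof (rule nn_integral_dominated_convergence)
    show "AE k in count_space UNIV. \<alpha> k * ennreal (window_modulus N k) \<le> \<alpha> k * ennreal (real CARD('n) + 1)" for N
      by (intro AE_I2 mult_left_mono ennreal_leI window_modulus_le) simp
    show "(\<integral>\<^sup>+k. \<alpha> k * ennreal (real CARD('n) + 1) \<partial>count_space UNIV) < \<infinity>"
      using \<alpha> by (simp add: nn_integral_multc ennreal_mult_less_top)
    have "(\<lambda>N. \<alpha> k * ennreal (window_modulus N k)) \<longlonglongrightarrow> 0" for k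
    proof -
      \<comment> \<open>Finiteness excludes the product \<open>top * 0\<close> in the limit.\<close>
      have "\<alpha> k < top"
        using \<alpha> le_nn_integral_count_space[of \<alpha> k] by (rule order_le_less_trans[rotated])
      have "(\<lambda>N. min (real CARD('n) + 1) ((\<Sum>i\<in>UNIV. \<bar>of_int (k $ i)\<bar> + 1) / real N)) \<longlonglongrightarrow> min (real CARD('n) + 1) 0"
        by (intro tendsto_min tendsto_const lim_const_over_n)
      then have "(\<lambda>N. window_modulus N k) \<longlonglongrightarrow> 0"
        by (simp add: window_modulus_def)
      then have "(\<lambda>N. \<alpha> k * ennreal (window_modulus N k)) \<longlonglongrightarrow> \<alpha> k * ennreal 0"
        using \<open>\<alpha> k < top\<close> by (intro tendsto_mult_ennreal tendsto_const tendsto_ennrealI) auto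
      then show ?thesis by simp
    qed
    then show "AE k in count_space UNIV. (\<lambda>N. \<alpha> k * ennreal (window_modulus N k)) \<longlonglongrightarrow> 0"
      by simp
  qed auto
  then show ?thesis by simp
qed

text \<open>Integer division of the floor by \<open>N\<close> is the floor of the quotient by
  \<open>N\<close>, and taking floors is additive up to an error of one.\<close>

lemma block_diff:
  fixes x y :: "real ^ 'n"
  assumes "0 < N"
  shows "block N x - block N y - (\<chi> i. floor_vec (x - y) $ i div int N) \<in> int_box 2"
proof -
  have "\<bar>\<lfloor>x $ i / real N\<rfloor> - \<lfloor>y $ i / real N\<rfloor> - \<lfloor>x $ i - y $ i\<rfloor> div int N\<bar> \<le> 2" for i
  proof -
    have "\<lfloor>x $ i - y $ i\<rfloor> div int N = \<lfloor>(x $ i - y $ i) / real N\<rfloor>"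
      using floor_divide_real_eq_div[of "int N" "x $ i - y $ i"] by simp
    then show ?thesis
      by (simp add: diff_divide_distrib) linarith
  qed
  then show ?thesis
    by (simp add: int_box_def)
qed

lemma block_count:
  fixes \<Lambda> :: "(real ^ 'n) set"
  assumes N: "0 < N"
    and K: "\<And>x k. (\<integral>\<^sup>+\<mu>. indicator {\<mu> \<in> \<Lambda>. floor_vec (\<mu> - x) = k} \<mu> \<partial>count_space UNIV) \<le> K"
  shows "(\<integral>\<^sup>+\<mu>. indicator {\<mu> \<in> \<Lambda>. block N \<mu> = n} \<mu> \<partial>count_space UNIV)
    \<le> of_nat (card (int_box (int N) :: (int ^ 'n) set)) * K"
proof (rule nn_integral_indicator_cover)
  \<comment> \<open>The lower corner of block \<open>n\<close>; a point of the block exceeds it by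
    less than \<open>N\<close> in each coordinate.\<close>
  let ?x = "\<chi> i. real N * of_int (n $ i)"
  show "\<exists>e\<in>int_box (int N). \<mu> \<in> {\<mu> \<in> \<Lambda>. floor_vec (\<mu> - ?x) = e}"
    if "\<mu> \<in> {\<mu> \<in> \<Lambda>. block N \<mu> = n}" for \<mu>
  proof -
    have "\<bar>floor_vec (\<mu> - ?x) $ i\<bar> \<le> int N" for i
    proof -
      have "n $ i = \<lfloor>\<mu> $ i / real N\<rfloor>"
        using that by auto
      then have "of_int (n $ i) \<le> \<mu> $ i / real N" "\<mu> $ i / real N < of_int (n $ i) + 1"
        by linarith+
      then have "real N * of_int (n $ i) \<le> \<mu> $ i" "\<mu> $ i < real N * of_int (n $ i) + real N"
        using N by (simp_all add: field_simps)
      then show ?thesis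
        by simp linarith
    qed
    then show ?thesis
      using that by (auto simp: int_box_def)
  qed
qed (simp, rule K)

text \<open>Young's convolution inequality as a case of Schur's test: all row and column sums of the
  kernel \<open>h (n - m)\<close> equal the sum of \<open>h\<close>.\<close>

lemma enorm_convolution:
  fixes h f :: "'k :: ab_group_add \<Rightarrow> ennreal"
  assumes p: "1 \<le> p" and h: "(\<integral>\<^sup>+k. h k \<partial>count_space UNIV) < top"
  shows "enorm p (\<lambda>n. \<integral>\<^sup>+m. h (n - m) * f m \<partial>count_space UNIV)
    \<le> (\<integral>\<^sup>+k. h k \<partial>count_space UNIV) * enorm p f"
proof (rule enorm_Schur[OF p h])
  fix n :: 'k
  have "bij_betw (\<lambda>m. n - m) UNIV UNIV"
    by (rule bij_betwI[where g = "\<lambda>m. n - m"]) auto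
  then show "(\<integral>\<^sup>+m. h (n - m) \<partial>count_space UNIV) \<le> (\<integral>\<^sup>+k. h k \<partial>count_space UNIV)"
    by (rule eq_refl[OF nn_integral_bij_count_space])
next
  fix m :: 'k
  have "bij_betw (\<lambda>n. n - m) UNIV UNIV"
    by (rule bij_betwI[where g = "\<lambda>n. n + m"]) auto
  then show "(\<integral>\<^sup>+n. h (n - m) \<partial>count_space UNIV) \<le> (\<integral>\<^sup>+k. h k \<partial>count_space UNIV)"
    by (rule eq_refl[OF nn_integral_bij_count_space])
qed

text \<open>An outer norm \<open>enorm q (block_norm p N f)\<close> is a Wiener amalgam norm, with
  local exponent \<open>p\<close> and global exponent \<open>q\<close>.\<close>

definition block_norm :: "ereal \<Rightarrow> nat \<Rightarrow> (real ^ 'n \<Rightarrow> ennreal) \<Rightarrow> int ^ 'n \<Rightarrow> ennreal" where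
  "block_norm p N f n = enorm p (\<lambda>x. f x * indicator {x. block N x = n} x)"

text \<open>Only the local exponent changes, at the price of the number of points per block.
  Together with \<open>enorm_block_norm\<close> this makes the amalgam norm with global exponent
  \<open>q\<close> comparable to the l^q norm.\<close>

lemma enorm_block_norm_compare:
  assumes p: "1 \<le> p" and q: "1 \<le> q" and r: "1 \<le> r"
    and supp: "\<And>x. x \<notin> \<Lambda> \<Longrightarrow> f x = 0"
    and D: "\<And>n. (\<integral>\<^sup>+\<mu>. indicator {\<mu> \<in> \<Lambda>. block N \<mu> = n} \<mu> \<partial>count_space UNIV) \<le> D"
  shows "enorm r (block_norm q N f) \<le> D * enorm r (block_norm p N f)"
proof -
  have "block_norm q N f n \<le> D * block_norm p N f n" for n
    unfolding block_norm_def
    by (rule enorm_le_enorm_of_support[OF p q _ D[of n]]) (auto simp: supp)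
  then have "enorm r (block_norm q N f) \<le> enorm r (\<lambda>n. D * block_norm p N f n)"
    by (intro enorm_mono r)
  then show ?thesis
    by (simp add: enorm_cmult[OF r])
qed

lemma enorm_block_norm: "1 \<le> p \<Longrightarrow> enorm p (block_norm p N f) = enorm p f"
  unfolding block_norm_def by (rule enorm_fibres)

text \<open>Finiteness of \<open>x\<close> is what permits subtracting \<open>B * x\<close>: for
  \<open>x = top\<close> and \<open>B\<close> positive the inequality carries no
  information.\<close>

lemma ennreal_absorb:
  fixes x A B :: ennreal
  assumes "x < top" "x \<le> A + B * x" "B \<le> ennreal (1 / 2)"
  shows "x \<le> 2 * A"
proof (cases "A = top")
  case False
  have B: "B < top"
    using assms(3) ennreal_less_top by (rule order_le_less_trans)
  obtain x' A' B' where r: "x = ennreal x'" "0 \<le> x'" "A = ennreal A'" "0 \<le> A'" "B = ennreal B'" "0 \<le> B'"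
    using assms(1) False B by (cases x; cases A; cases B) auto
  have "B' \<le> 1 / 2"
    using assms(3) r by (simp only: ennreal_le_iff)
  moreover have "x' \<le> A' + B' * x'"
    using assms(2) r by (simp flip: ennreal_mult ennreal_plus)
  ultimately have "x' \<le> 2 * A'"
    using mult_right_mono[of B' "1/2" x'] r by simp
  then have "ennreal x' \<le> ennreal (2 * A')"
    by (rule ennreal_leI)
  then show ?thesis
    using r by (simp add: ennreal_mult)
qed (simp add: ennreal_mult_top)

subsection \<open>Matrices with summable off-diagonal decay\<close>

text \<open>\<open>count_rows\<close> and \<open>count_cols\<close> feed Schur's test;
  \<open>count'\<close> and \<open>count_cols\<close> bound the number of points of
  \<open>\<Lambda>'\<close> and \<open>\<Lambda>\<close> in a block.\<close>

locale localized_matrix =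
  fixes \<Lambda> \<Lambda>' :: "(real ^ 'n) set" and a :: "real ^ 'n \<Rightarrow> real ^ 'n \<Rightarrow> complex"
    and \<alpha> :: "int ^ 'n \<Rightarrow> ennreal" and K :: ennreal
  assumes K: "K < top"
    and count_rows: "\<And>x k. (\<integral>\<^sup>+\<nu>. indicator {\<nu> \<in> \<Lambda>'. floor_vec (x - \<nu>) = k} \<nu> \<partial>count_space UNIV) \<le> K"
    and count_cols: "\<And>x k. (\<integral>\<^sup>+\<mu>. indicator {\<mu> \<in> \<Lambda>. floor_vec (\<mu> - x) = k} \<mu> \<partial>count_space UNIV) \<le> K"
    and count': "\<And>x k. (\<integral>\<^sup>+\<nu>. indicator {\<nu> \<in> \<Lambda>'. floor_vec (\<nu> - x) = k} \<nu> \<partial>count_space UNIV) \<le> K"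
    and \<alpha>: "(\<integral>\<^sup>+k. \<alpha> k \<partial>count_space UNIV) < top"
    and entry_le: "\<And>\<mu> \<nu>. \<mu> \<in> \<Lambda> \<Longrightarrow> \<nu> \<in> \<Lambda>' \<Longrightarrow> ennreal (norm (a \<mu> \<nu>)) \<le> \<alpha> (floor_vec (\<mu> - \<nu>))"
begin

text \<open>The majorant \<open>\<phi>\<close> is left free because the lemma serves both the
  matrix, with \<alpha>, and the part of a commutator with columns in one block, with a
  \<open>commutator_kernel\<close>.\<close>

lemma enorm_kernel_le:
  assumes p: "1 \<le> p" and \<phi>: "(\<integral>\<^sup>+k. \<phi> k \<partial>count_space UNIV) < top"
    and b: "\<And>\<mu> \<nu>. b \<mu> \<nu> \<le> indicator \<Lambda> \<mu> * indicator \<Lambda>' \<nu> * \<phi> (floor_vec (\<mu> - \<nu>))"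
  shows "enorm p (\<lambda>\<mu>. \<integral>\<^sup>+\<nu>. b \<mu> \<nu> * f \<nu> \<partial>count_space UNIV)
    \<le> K * (\<integral>\<^sup>+k. \<phi> k \<partial>count_space UNIV) * enorm p f"
proof (rule enorm_Schur[OF p])
  show "K * (\<integral>\<^sup>+k. \<phi> k \<partial>count_space UNIV) < top"
    using K \<phi> by (simp add: ennreal_mult_less_top)
next
  fix \<mu>
  have "(\<integral>\<^sup>+\<nu>. b \<mu> \<nu> \<partial>count_space UNIV)
      \<le> (\<integral>\<^sup>+\<nu>. indicator \<Lambda>' \<nu> * \<phi> (floor_vec (\<mu> - \<nu>)) \<partial>count_space UNIV)"
    by (intro nn_integral_mono order_trans[OF b]) (auto split: split_indicator)
  also have "\<dots> \<le> K * (\<integral>\<^sup>+k. \<phi> k \<partial>count_space UNIV)"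
    by (rule nn_integral_comp_le[OF count_rows])
  finally show "(\<integral>\<^sup>+\<nu>. b \<mu> \<nu> \<partial>count_space UNIV) \<le> K * (\<integral>\<^sup>+k. \<phi> k \<partial>count_space UNIV)" .
next
  fix \<nu>
  have "(\<integral>\<^sup>+\<mu>. b \<mu> \<nu> \<partial>count_space UNIV)
      \<le> (\<integral>\<^sup>+\<mu>. indicator \<Lambda> \<mu> * \<phi> (floor_vec (\<mu> - \<nu>)) \<partial>count_space UNIV)"
    by (intro nn_integral_mono order_trans[OF b]) (auto split: split_indicator)
  also have "\<dots> \<le> K * (\<integral>\<^sup>+k. \<phi> k \<partial>count_space UNIV)"
    by (rule nn_integral_comp_le[OF count_cols])
  finally show "(\<integral>\<^sup>+\<mu>. b \<mu> \<nu> \<partial>count_space UNIV) \<le> K * (\<integral>\<^sup>+k. \<phi> k \<partial>count_space UNIV)" .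
qed

section \<open>Boundedness of the matrix on every sequence space\<close>

definition entry :: "real ^ 'n \<Rightarrow> real ^ 'n \<Rightarrow> ennreal" where
  "entry \<mu> \<nu> = indicator \<Lambda> \<mu> * abs_ext \<Lambda>' (a \<mu>) \<nu>"

lemma entry_bound: "entry \<mu> \<nu> \<le> indicator \<Lambda> \<mu> * indicator \<Lambda>' \<nu> * \<alpha> (floor_vec (\<mu> - \<nu>))"
  by (auto simp: entry_def abs_ext_def entry_le split: split_indicator)

lemma nn_integral_entry_less_top:
  assumes "enorm \<infinity> f < top"
  shows "(\<integral>\<^sup>+\<nu>. entry \<mu> \<nu> * f \<nu> \<partial>count_space UNIV) < top"
proof -
  have "(\<integral>\<^sup>+\<nu>. entry \<mu> \<nu> * f \<nu> \<partial>count_space UNIV)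
      \<le> enorm \<infinity> (\<lambda>\<mu>. \<integral>\<^sup>+\<nu>. entry \<mu> \<nu> * f \<nu> \<partial>count_space UNIV)"
    by (rule le_enorm) simp
  also have "\<dots> \<le> K * (\<integral>\<^sup>+k. \<alpha> k \<partial>count_space UNIV) * enorm \<infinity> f"
    by (rule enorm_kernel_le[OF _ \<alpha> entry_bound]) simp
  also have "\<dots> < top"
    using assms K \<alpha> by (simp add: ennreal_mult_less_top)
  finally show ?thesis .
qed

text \<open>Boundedness of \<open>c\<close> is the common hypothesis for all exponents, by
  \<open>enorm_infinity_less_top\<close>.\<close>

lemma mat_apply_summable:
  assumes "enorm \<infinity> (abs_ext \<Lambda>' c) < top" and \<mu>: "\<mu> \<in> \<Lambda>"
  shows "(\<lambda>\<nu>. a \<mu> \<nu> * c \<nu>) summable_on \<Lambda>'"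
    and "ennreal (norm (mat_apply \<Lambda>' a c \<mu>)) \<le> (\<integral>\<^sup>+\<nu>. entry \<mu> \<nu> * abs_ext \<Lambda>' c \<nu> \<partial>count_space UNIV)"
proof -
  have eq: "abs_ext \<Lambda>' (\<lambda>\<nu>. a \<mu> \<nu> * c \<nu>) \<nu> = entry \<mu> \<nu> * abs_ext \<Lambda>' c \<nu>" for \<nu>
    using \<mu> by (simp add: abs_ext_def entry_def norm_mult ennreal_mult)
  have "(\<integral>\<^sup>+\<nu>. abs_ext \<Lambda>' (\<lambda>\<nu>. a \<mu> \<nu> * c \<nu>) \<nu> \<partial>count_space UNIV) < top"
    unfolding eq by (rule nn_integral_entry_less_top[OF assms(1)])
  from summable_on_of_nn_integral_abs_ext[OF this]
  show "(\<lambda>\<nu>. a \<mu> \<nu> * c \<nu>) summable_on \<Lambda>'"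
    "ennreal (norm (mat_apply \<Lambda>' a c \<mu>)) \<le> (\<integral>\<^sup>+\<nu>. entry \<mu> \<nu> * abs_ext \<Lambda>' c \<nu> \<partial>count_space UNIV)"
    by (simp_all add: mat_apply_def eq)
qed

lemma enorm_mat_apply_le:
  assumes q: "1 \<le> q" and c: "enorm q (abs_ext \<Lambda>' c) < top"
  shows "enorm q (abs_ext \<Lambda> (mat_apply \<Lambda>' a c))
    \<le> K * (\<integral>\<^sup>+k. \<alpha> k \<partial>count_space UNIV) * enorm q (abs_ext \<Lambda>' c)"
proof -
  have "abs_ext \<Lambda> (mat_apply \<Lambda>' a c) \<mu> \<le> (\<integral>\<^sup>+\<nu>. entry \<mu> \<nu> * abs_ext \<Lambda>' c \<nu> \<partial>count_space UNIV)" for \<mu>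
    using mat_apply_summable(2)[OF enorm_infinity_less_top[OF q c], of \<mu>]
    by (cases "\<mu> \<in> \<Lambda>") (simp_all add: abs_ext_def)
  then have "enorm q (abs_ext \<Lambda> (mat_apply \<Lambda>' a c))
      \<le> enorm q (\<lambda>\<mu>. \<integral>\<^sup>+\<nu>. entry \<mu> \<nu> * abs_ext \<Lambda>' c \<nu> \<partial>count_space UNIV)"
    by (intro enorm_mono q)
  also have "\<dots> \<le> K * (\<integral>\<^sup>+k. \<alpha> k \<partial>count_space UNIV) * enorm q (abs_ext \<Lambda>' c)"
    by (rule enorm_kernel_le[OF q \<alpha> entry_bound])
  finally show ?thesis .
qed

section \<open>Commutators with windows\<close>

lemma commutator_le:
  fixes w :: "real ^ 'n \<Rightarrow> real"
  assumes c: "enorm \<infinity> (abs_ext \<Lambda>' c) < top" and \<mu>: "\<mu> \<in> \<Lambda>"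
    and w: "\<And>x. 0 \<le> w x" "\<And>x. w x \<le> B"
  shows "ennreal (norm (mat_apply \<Lambda>' a (\<lambda>\<nu>. of_real (w \<nu>) * c \<nu>) \<mu>))
    \<le> ennreal (w \<mu>) * ennreal (norm (mat_apply \<Lambda>' a c \<mu>))
      + (\<integral>\<^sup>+\<nu>. entry \<mu> \<nu> * ennreal \<bar>w \<mu> - w \<nu>\<bar> * abs_ext \<Lambda>' c \<nu> \<partial>count_space UNIV)"
    (is "_ \<le> _ + ?I")
proof -
  \<comment> \<open>With \<mu> frozen, the commutator at \<mu> is the matrix applied to this
    sequence. It is bounded, since both window values lie between 0 and \<open>B\<close>, so its
    series converges and may be subtracted termwise.\<close>
  let ?d = "\<lambda>\<nu>. of_real (w \<mu> - w \<nu>) * c \<nu>"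
  have abs_d: "abs_ext \<Lambda>' ?d \<nu> = ennreal \<bar>w \<mu> - w \<nu>\<bar> * abs_ext \<Lambda>' c \<nu>" for \<nu>
    by (simp add: abs_ext_def norm_mult ennreal_mult flip: of_real_diff)
  have "enorm \<infinity> (abs_ext \<Lambda>' ?d) \<le> enorm \<infinity> (\<lambda>\<nu>. ennreal B * abs_ext \<Lambda>' c \<nu>)"
  proof (rule enorm_mono)
    fix \<nu>
    have "\<bar>w \<mu> - w \<nu>\<bar> \<le> B"
      using w(1)[of \<mu>] w(2)[of \<mu>] w(1)[of \<nu>] w(2)[of \<nu>] by linarith
    then show "abs_ext \<Lambda>' ?d \<nu> \<le> ennreal B * abs_ext \<Lambda>' c \<nu>"
      unfolding abs_d by (intro mult_right_mono ennreal_leI) auto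
  qed simp
  also have "\<dots> < top"
    using c by (simp add: enorm_cmult ennreal_mult_less_top)
  finally have d: "enorm \<infinity> (abs_ext \<Lambda>' ?d) < top" .
  note sum_c = mat_apply_summable[OF c \<mu>] and sum_d = mat_apply_summable[OF d \<mu>]
  have "((\<lambda>\<nu>. - (a \<mu> \<nu> * ?d \<nu>)) has_sum - mat_apply \<Lambda>' a ?d \<mu>) \<Lambda>'"
    unfolding mat_apply_def has_sum_uminus minus_minus by (rule has_sum_infsum[OF sum_d(1)])
  moreover have "((\<lambda>\<nu>. of_real (w \<mu>) * (a \<mu> \<nu> * c \<nu>)) has_sum of_real (w \<mu>) * mat_apply \<Lambda>' a c \<mu>) \<Lambda>'"
    unfolding mat_apply_def by (rule has_sum_cmult_right[OF has_sum_infsum[OF sum_c(1)]])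
  ultimately have "((\<lambda>\<nu>. of_real (w \<mu>) * (a \<mu> \<nu> * c \<nu>) + - (a \<mu> \<nu> * ?d \<nu>)) has_sum
      of_real (w \<mu>) * mat_apply \<Lambda>' a c \<mu> + - mat_apply \<Lambda>' a ?d \<mu>) \<Lambda>'"
    by (rule has_sum_add[rotated])
  then have "mat_apply \<Lambda>' a (\<lambda>\<nu>. of_real (w \<nu>) * c \<nu>) \<mu>
      = of_real (w \<mu>) * mat_apply \<Lambda>' a c \<mu> - mat_apply \<Lambda>' a ?d \<mu>"
    by (subst mat_apply_def) (auto simp: algebra_simps dest!: infsumI)
  then have "norm (mat_apply \<Lambda>' a (\<lambda>\<nu>. of_real (w \<nu>) * c \<nu>) \<mu>)
      \<le> w \<mu> * norm (mat_apply \<Lambda>' a c \<mu>) + norm (mat_apply \<Lambda>' a ?d \<mu>)"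
    using norm_triangle_ineq4[of "of_real (w \<mu>) * mat_apply \<Lambda>' a c \<mu>"] w(1)[of \<mu>]
    by (simp add: norm_mult)
  then have "ennreal (norm (mat_apply \<Lambda>' a (\<lambda>\<nu>. of_real (w \<nu>) * c \<nu>) \<mu>))
      \<le> ennreal (w \<mu>) * ennreal (norm (mat_apply \<Lambda>' a c \<mu>)) + ennreal (norm (mat_apply \<Lambda>' a ?d \<mu>))"
    using w(1)[of \<mu>] by (simp flip: ennreal_mult ennreal_plus)
  also have "\<dots> \<le> ennreal (w \<mu>) * ennreal (norm (mat_apply \<Lambda>' a c \<mu>)) + ?I"
    using sum_d(2) unfolding abs_d by (intro add_left_mono) (simp only: mult.assoc)
  finally show ?thesis .
qed

text \<open>The reach \<open>CARD('n) + 2\<close> of a window, from \<open>window_support\<close>,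
  plus the error 2 of \<open>block_diff\<close>.\<close>

definition radius :: int where "radius = int CARD('n) + 4"

text \<open>
  An entry of the commutator of the matrix with the window at block \<open>n\<close> whose column lies in block
  \<open>m\<close> vanishes unless the column or the row is near block \<open>n\<close>. In the second case \<open>n - m\<close> is,
  up to a bounded error, the block of the difference of row and column. Hence the
  two indicators in the majorant below, whose sums over \<open>j = n - m\<close> do not depend on \<open>N\<close>.
\<close>

definition commutator_kernel :: "nat \<Rightarrow> int ^ 'n \<Rightarrow> int ^ 'n \<Rightarrow> ennreal" where
  "commutator_kernel N j k = \<alpha> k * ennreal (window_modulus N k) *
     (indicator (int_box radius) j + indicator (int_box radius) (j - (\<chi> i. k $ i div int N)))"

text \<open>Summing over \<open>j\<close> first, the second box is a translate of the first and
  contributes the same count, whence the factor 2.\<close>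

lemma nn_integral_commutator_kernel:
  "(\<integral>\<^sup>+j. \<integral>\<^sup>+k. commutator_kernel N j k \<partial>count_space UNIV \<partial>count_space UNIV)
    = of_nat (2 * card (int_box radius :: (int ^ 'n) set)) * (\<integral>\<^sup>+k. \<alpha> k * ennreal (window_modulus N k) \<partial>count_space UNIV)"
proof -
  have box: "(\<integral>\<^sup>+j. indicator (int_box radius) j \<partial>count_space (UNIV :: (int ^ 'n) set))
      = of_nat (card (int_box radius :: (int ^ 'n) set))"
    by simp
  have shift: "(\<integral>\<^sup>+j. indicator (int_box radius) (j - t) \<partial>count_space (UNIV :: (int ^ 'n) set))
      = of_nat (card (int_box radius :: (int ^ 'n) set))" for t
  proof -
    have "bij_betw (\<lambda>j :: int ^ 'n. j - t) UNIV UNIV"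
      by (rule bij_betwI[where g = "\<lambda>j. j + t"]) auto
    from nn_integral_bij_count_space[OF this, of "indicator (int_box radius)"] show ?thesis
      by simp
  qed
  have "(\<integral>\<^sup>+j. commutator_kernel N j k \<partial>count_space UNIV)
      = of_nat (2 * card (int_box radius :: (int ^ 'n) set)) * (\<alpha> k * ennreal (window_modulus N k))" for k
    by (simp only: commutator_kernel_def nn_integral_cmult[OF borel_measurable_count_space]
      nn_integral_add[OF borel_measurable_count_space borel_measurable_count_space] box shift)
      (simp add: mult_2 distrib_left distrib_right mult_ac)
  then show ?thesis
    by (subst nn_integral_count_space_swap) (simp add: nn_integral_cmult)
qed

lemma commutator_entry_le:
  assumes N: "0 < N"
  shows "entry \<mu> \<nu> * ennreal \<bar>window N n \<mu> - window N n \<nu>\<bar> * indicator {\<nu>. block N \<nu> = m} \<nu>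
    \<le> indicator \<Lambda> \<mu> * indicator \<Lambda>' \<nu> * commutator_kernel N (n - m) (floor_vec (\<mu> - \<nu>))"
proof (cases "\<mu> \<in> \<Lambda> \<and> \<nu> \<in> \<Lambda>' \<and> block N \<nu> = m \<and> window N n \<mu> \<noteq> window N n \<nu>")
  case False
  then show ?thesis
    by (auto simp: entry_def abs_ext_def)
next
  case True
  let ?k = "floor_vec (\<mu> - \<nu>)"
  let ?t = "\<chi> i. ?k $ i div int N"
  have "n - m \<in> int_box radius \<or> n - m - ?t \<in> int_box radius"
  \<comment> \<open>The window values differ, so at least one is nonzero. If it is the one at \<mu>,
    the path from \<open>n\<close> to \<open>m\<close> passes through the block of \<mu>, and the
    two errors add up to at most \<open>radius\<close>.\<close>
  proof (cases "window N n \<nu> = 0")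
    case False
    then show ?thesis
      using window_support[OF False] True int_box_mono[of "int CARD('n) + 2" radius] by (auto simp: radius_def)
  next
    case zero: True
    with True have "window N n \<mu> \<noteq> 0" by auto
    then have 1: "n - block N \<mu> \<in> int_box (int CARD('n) + 2)"
      by (rule window_support)
    have 2: "block N \<mu> - block N \<nu> - ?t \<in> int_box 2"
      using block_diff[OF N] by simp
    have "\<bar>(n - m - ?t) $ i\<bar> \<le> radius" for i
    proof -
      have "\<bar>(n - block N \<mu>) $ i\<bar> \<le> int CARD('n) + 2" "\<bar>(block N \<mu> - block N \<nu> - ?t) $ i\<bar> \<le> 2"
        using 1 2 unfolding int_box_def by blast+
      moreover have "(n - m - ?t) $ i = (n - block N \<mu>) $ i + (block N \<mu> - block N \<nu> - ?t) $ i"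
        using True by simp
      ultimately show ?thesis
        unfolding radius_def by linarith
    qed
    then show ?thesis
      by (simp add: int_box_def)
  qed
  then have box: "(1 :: ennreal) \<le> indicator (int_box radius) (n - m) + indicator (int_box radius) (n - m - ?t)"
    by (auto split: split_indicator)
  have "ennreal (norm (a \<mu> \<nu>)) * ennreal \<bar>window N n \<mu> - window N n \<nu>\<bar> * 1
      \<le> \<alpha> ?k * ennreal (window_modulus N ?k) *
        (indicator (int_box radius) (n - m) + indicator (int_box radius) (n - m - ?t))"
    using True by (intro mult_mono entry_le ennreal_leI window_diff_le box) auto
  then show ?thesis
    using True by (simp add: entry_def abs_ext_def commutator_kernel_def)
qed

text \<open>The lower bound in l^p is applied to the windowed sequence \<open>d\<close>, although
  \<open>c\<close> itself is only known to lie in l^q. Minkowski's inequality splits both resulting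
  terms over blocks.\<close>

lemma local_estimate:
  fixes N :: nat and C :: ennreal
  assumes N: "0 < N" and p: "1 \<le> p" and q: "1 \<le> q"
    and lower: "\<And>c. enorm p (abs_ext \<Lambda>' c) < top \<Longrightarrow>
      enorm p (abs_ext \<Lambda>' c) \<le> C * enorm p (abs_ext \<Lambda> (mat_apply \<Lambda>' a c))"
    and c: "enorm q (abs_ext \<Lambda>' c) < top"
    and \<beta>: "(\<integral>\<^sup>+k. \<alpha> k * ennreal (window_modulus N k) \<partial>count_space UNIV) < top"
  shows "block_norm p N (abs_ext \<Lambda>' c) n \<le> C * (
    (\<integral>\<^sup>+m. ennreal (real CARD('n) + 1) * indicator (int_box radius) (n - m)
        * block_norm p N (abs_ext \<Lambda> (mat_apply \<Lambda>' a c)) m \<partial>count_space UNIV)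
    + (\<integral>\<^sup>+m. K * (\<integral>\<^sup>+k. commutator_kernel N (n - m) k \<partial>count_space UNIV)
        * block_norm p N (abs_ext \<Lambda>' c) m \<partial>count_space UNIV))"
proof -
  define w where "w = window N n"
  define d where "d \<nu> = complex_of_real (w \<nu>) * c \<nu>" for \<nu>
  let ?c = "abs_ext \<Lambda>' c" and ?Ac = "abs_ext \<Lambda> (mat_apply \<Lambda>' a c)"
  let ?\<rho> = "real CARD('n) + 1"
  have w: "0 \<le> w x" "w x \<le> ?\<rho>" for x
    by (simp_all add: w_def window_nonneg window_le)
  have abs_d: "abs_ext \<Lambda>' d \<nu> = ennreal (w \<nu>) * ?c \<nu>" for \<nu>
    using w(1) by (simp add: d_def abs_ext_def norm_mult ennreal_mult)
  have c_inf: "enorm \<infinity> ?c < top"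
    by (rule enorm_infinity_less_top[OF q c])
  \<comment> \<open>\<open>d\<close> is bounded and lives on finitely many blocks with boundedly
    many points each, so its norm is finite in every exponent.\<close>
  have d_fin: "enorm p (abs_ext \<Lambda>' d) < top"
  proof -
    define F where "F = {\<nu> \<in> \<Lambda>'. n - block N \<nu> \<in> int_box (int CARD('n) + 2)}"
    define D where "D = of_nat (card (int_box (int CARD('n) + 2) :: (int ^ 'n) set))
      * (of_nat (card (int_box (int N) :: (int ^ 'n) set)) * K)"
    have "(\<integral>\<^sup>+\<nu>. indicator F \<nu> \<partial>count_space UNIV) \<le> D"
      unfolding D_def
    proof (rule nn_integral_indicator_cover)
      show "\<exists>e\<in>int_box (int CARD('n) + 2). \<nu> \<in> {\<nu> \<in> \<Lambda>'. block N \<nu> = n - e}" if "\<nu> \<in> F" for \<nu>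
        using that by (intro bexI[of _ "n - block N \<nu>"]) (auto simp: F_def)
    qed (simp, rule block_count[OF N count'])
    moreover have "abs_ext \<Lambda>' d \<nu> = 0" if "\<nu> \<notin> F" for \<nu>
      using that window_support[of N n \<nu>] by (auto simp: F_def abs_ext_def d_def w_def)
    ultimately have "enorm p (abs_ext \<Lambda>' d) \<le> D * enorm \<infinity> (abs_ext \<Lambda>' d)"
      by (intro enorm_le_enorm_of_support[of \<infinity> p F] p) auto
    also have "enorm \<infinity> (abs_ext \<Lambda>' d) \<le> enorm \<infinity> (\<lambda>\<nu>. ennreal ?\<rho> * ?c \<nu>)"
      unfolding abs_d by (intro enorm_mono mult_right_mono ennreal_leI w) auto
    also have "D * \<dots> < top"
      using K c_inf by (simp add: D_def enorm_cmult ennreal_mult_less_top of_nat_less_top)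
    finally show ?thesis
      by (simp add: mult_left_mono)
  qed
  define P where "P m \<mu> = ennreal ?\<rho> * indicator (int_box radius) (n - m) * (?Ac \<mu> * indicator {\<mu>. block N \<mu> = m} \<mu>)" for m \<mu>
  \<comment> \<open>The indicator of block \<open>m\<close> appears twice: one copy localises the
    kernel for \<open>commutator_entry_le\<close>, the other cuts \<open>?c\<close> down to the
    block to produce its \<open>block_norm\<close>.\<close>
  define Q where "Q m \<mu> = (\<integral>\<^sup>+\<nu>. entry \<mu> \<nu> * ennreal \<bar>w \<mu> - w \<nu>\<bar> * indicator {\<nu>. block N \<nu> = m} \<nu>
      * (?c \<nu> * indicator {\<nu>. block N \<nu> = m} \<nu>) \<partial>count_space UNIV)" for m \<mu>
  have "abs_ext \<Lambda> (mat_apply \<Lambda>' a d) \<mu>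
      \<le> (\<integral>\<^sup>+m. P m \<mu> \<partial>count_space UNIV) + (\<integral>\<^sup>+m. Q m \<mu> \<partial>count_space UNIV)" for \<mu>
  proof (cases "\<mu> \<in> \<Lambda>")
    case True
    have "ennreal (w \<mu>) * ?Ac \<mu> \<le> P (block N \<mu>) \<mu>"
    proof (cases "w \<mu> = 0")
      case False
      then have "n - block N \<mu> \<in> int_box radius"
        using window_support[of N n \<mu>] int_box_mono[of "int CARD('n) + 2" radius] by (auto simp: w_def radius_def)
      then show ?thesis
        using w(2)[of \<mu>] by (simp add: P_def mult_right_mono ennreal_leI del: ennreal_plus)
    qed simp
    also have "\<dots> \<le> (\<integral>\<^sup>+m. P m \<mu> \<partial>count_space UNIV)"
      by (rule le_nn_integral_count_space)
    finally have 1: "ennreal (w \<mu>) * ennreal (norm (mat_apply \<Lambda>' a c \<mu>)) \<le> (\<integral>\<^sup>+m. P m \<mu> \<partial>count_space UNIV)"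
      using True by (simp add: abs_ext_def)
    have Q_eq: "(\<integral>\<^sup>+\<nu>. entry \<mu> \<nu> * ennreal \<bar>w \<mu> - w \<nu>\<bar> * ?c \<nu> \<partial>count_space UNIV)
        = (\<integral>\<^sup>+m. Q m \<mu> \<partial>count_space UNIV)"
      unfolding Q_def
      by (subst nn_integral_count_space_fibres[of _ "block N"])
        (auto intro!: nn_integral_cong split: split_indicator)
    have "d = (\<lambda>\<nu>. of_real (w \<nu>) * c \<nu>)"
      by (simp add: d_def fun_eq_iff)
    then have "ennreal (norm (mat_apply \<Lambda>' a d \<mu>))
        \<le> ennreal (w \<mu>) * ennreal (norm (mat_apply \<Lambda>' a c \<mu>)) + (\<integral>\<^sup>+m. Q m \<mu> \<partial>count_space UNIV)"
      using commutator_le[where w = w, OF c_inf True w] by (simp only: Q_eq)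
    also have "\<dots> \<le> (\<integral>\<^sup>+m. P m \<mu> \<partial>count_space UNIV) + (\<integral>\<^sup>+m. Q m \<mu> \<partial>count_space UNIV)"
      by (intro add_right_mono 1)
    finally show ?thesis
      using True by (simp add: abs_ext_def)
  qed (simp add: abs_ext_def)
  then have "enorm p (abs_ext \<Lambda> (mat_apply \<Lambda>' a d))
      \<le> enorm p (\<lambda>\<mu>. (\<integral>\<^sup>+m. P m \<mu> \<partial>count_space UNIV) + (\<integral>\<^sup>+m. Q m \<mu> \<partial>count_space UNIV))"
    by (intro enorm_mono p)
  also have "\<dots> \<le> (\<integral>\<^sup>+m. enorm p (P m) \<partial>count_space UNIV) + (\<integral>\<^sup>+m. enorm p (Q m) \<partial>count_space UNIV)"
    by (intro order_trans[OF enorm_triangle[OF p]] add_mono enorm_Minkowski p)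
  also have "\<dots> \<le> (\<integral>\<^sup>+m. ennreal ?\<rho> * indicator (int_box radius) (n - m) * block_norm p N ?Ac m \<partial>count_space UNIV)
    + (\<integral>\<^sup>+m. K * (\<integral>\<^sup>+k. commutator_kernel N (n - m) k \<partial>count_space UNIV) * block_norm p N ?c m \<partial>count_space UNIV)"
  proof (intro add_mono nn_integral_mono)
    fix m
    show "enorm p (P m) \<le> ennreal ?\<rho> * indicator (int_box radius) (n - m) * block_norm p N ?Ac m"
      unfolding P_def block_norm_def by (simp only: enorm_cmult[OF p] order_refl)
    \<comment> \<open>Schur's test needs a finite kernel sum at the single shift
      \<open>n - m\<close>; it is one term of the finite sum over all shifts.\<close>
    have "(\<integral>\<^sup>+k. commutator_kernel N (n - m) k \<partial>count_space UNIV)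
        \<le> (\<integral>\<^sup>+j. \<integral>\<^sup>+k. commutator_kernel N j k \<partial>count_space UNIV \<partial>count_space UNIV)"
      by (rule le_nn_integral_count_space)
    also have "\<dots> < top"
      unfolding nn_integral_commutator_kernel using \<beta> by (simp add: ennreal_mult_less_top of_nat_less_top)
    finally show "enorm p (Q m) \<le> K * (\<integral>\<^sup>+k. commutator_kernel N (n - m) k \<partial>count_space UNIV) * block_norm p N ?c m"
      unfolding Q_def block_norm_def w_def by (rule enorm_kernel_le[OF p _ commutator_entry_le[OF N]])
  qed
  finally have Ad: "enorm p (abs_ext \<Lambda> (mat_apply \<Lambda>' a d)) \<le> \<dots>" .
  \<comment> \<open>The window is at least one on its own block, so there \<open>d\<close> dominates
    \<open>c\<close>.\<close>
  have "block_norm p N ?c n \<le> enorm p (abs_ext \<Lambda>' d)"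
    unfolding block_norm_def
  proof (rule enorm_mono[OF p])
    fix \<nu>
    show "?c \<nu> * indicator {\<nu>. block N \<nu> = n} \<nu> \<le> abs_ext \<Lambda>' d \<nu>"
    proof (cases "block N \<nu> = n")
      case True
      then have "1 \<le> ennreal (w \<nu>)"
        using window_block_ge_1[of N \<nu>] by (simp add: w_def)
      from mult_right_mono[OF this, of "?c \<nu>"] show ?thesis
        using True by (simp add: abs_d)
    qed simp
  qed
  also have "\<dots> \<le> C * enorm p (abs_ext \<Lambda> (mat_apply \<Lambda>' a d))"
    by (rule lower[OF d_fin])
  also note Ad
  finally show ?thesis
    by (simp add: mult_left_mono)
qed

text \<open>The scale \<open>N\<close> is fixed before any \<open>c\<close> is given, which makes
  the final constant uniform in \<open>c\<close>.\<close>

lemma lower_bound_transfer: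
  fixes C :: ennreal
  assumes p: "1 \<le> p" and q: "1 \<le> q" and C: "C < top"
    and lower: "\<And>c. enorm p (abs_ext \<Lambda>' c) < top \<Longrightarrow>
      enorm p (abs_ext \<Lambda>' c) \<le> C * enorm p (abs_ext \<Lambda> (mat_apply \<Lambda>' a c))"
  obtains B where "B < top"
    "\<And>c. enorm q (abs_ext \<Lambda>' c) < top \<Longrightarrow>
      enorm q (abs_ext \<Lambda>' c) \<le> B * enorm q (abs_ext \<Lambda> (mat_apply \<Lambda>' a c))"
proof -
  \<comment> \<open>Chosen so that \<open>M\<close> times the sum of the weighted moduli is
    \<open>C * G\<close>, the factor in front of the term to be absorbed; it is made smaller than
    one half below.\<close>
  define M where "M = of_nat (2 * card (int_box radius :: (int ^ 'n) set)) * (K * C)"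
  have M: "M < top"
    using K C by (simp add: M_def ennreal_mult_less_top of_nat_less_top del: of_nat_mult)
  have "(\<lambda>N. M * (\<integral>\<^sup>+k. \<alpha> k * ennreal (window_modulus N k) \<partial>count_space UNIV)) \<longlonglongrightarrow> M * 0"
    using M by (intro tendsto_mult_ennreal tendsto_const nn_integral_window_modulus_tendsto_0 \<alpha>) auto
  then have "eventually (\<lambda>N. M * (\<integral>\<^sup>+k. \<alpha> k * ennreal (window_modulus N k) \<partial>count_space UNIV) < ennreal (1 / 2)) sequentially"
    by (rule order_tendstoD) (subst mult_zero_right, subst ennreal_less_zero_iff, simp)
  moreover have "eventually (\<lambda>N. (\<integral>\<^sup>+k. \<alpha> k * ennreal (window_modulus N k) \<partial>count_space UNIV) < top) sequentially"
    using nn_integral_window_modulus_tendsto_0[OF \<alpha>] by (rule order_tendstoD) simp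
  ultimately have "eventually (\<lambda>N. 0 < N \<and> M * (\<integral>\<^sup>+k. \<alpha> k * ennreal (window_modulus N k) \<partial>count_space UNIV) < ennreal (1 / 2)
      \<and> (\<integral>\<^sup>+k. \<alpha> k * ennreal (window_modulus N k) \<partial>count_space UNIV) < top) sequentially"
    by (intro eventually_conj eventually_gt_at_top)
  then obtain N where N: "0 < N"
    and small: "M * (\<integral>\<^sup>+k. \<alpha> k * ennreal (window_modulus N k) \<partial>count_space UNIV) < ennreal (1 / 2)"
    and \<beta>: "(\<integral>\<^sup>+k. \<alpha> k * ennreal (window_modulus N k) \<partial>count_space UNIV) < top"
    using eventually_happens'[OF sequentially_bot] by blast
  define D where "D = of_nat (card (int_box (int N) :: (int ^ 'n) set)) * K"
  have D: "D < top"
    using K by (simp add: D_def ennreal_mult_less_top of_nat_less_top)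
  note D' = block_count[OF N count', folded D_def] and D'' = block_count[OF N count_cols, folded D_def]
  define h where "h j = ennreal (real CARD('n) + 1) * indicator (int_box radius) j" for j :: "int ^ 'n"
  define g where "g j = K * (\<integral>\<^sup>+k. commutator_kernel N j k \<partial>count_space UNIV)" for j :: "int ^ 'n"
  define H where "H = (\<integral>\<^sup>+j. h j \<partial>count_space UNIV)"
  define G where "G = (\<integral>\<^sup>+j. g j \<partial>count_space UNIV)"
  have H: "H < top"
    by (simp add: H_def h_def nn_integral_cmult ennreal_mult_less_top of_nat_less_top del: ennreal_plus)
  have G: "G = K * (of_nat (2 * card (int_box radius :: (int ^ 'n) set))
      * (\<integral>\<^sup>+k. \<alpha> k * ennreal (window_modulus N k) \<partial>count_space UNIV))"
    by (simp only: G_def g_def nn_integral_cmult[OF borel_measurable_count_space] nn_integral_commutator_kernel)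
  then have G_fin: "G < top"
    using K \<beta> by (simp add: ennreal_mult_less_top of_nat_less_top del: of_nat_mult)
  have CG: "C * G \<le> ennreal (1 / 2)"
    using small by (simp add: G M_def mult_ac del: of_nat_mult)
  show ?thesis
  proof (rule that)
    \<comment> \<open>The two factors \<open>D\<close> pay for the change of local exponent, once
      for \<open>c\<close> and once for its image; the 2 comes from the absorption.\<close>
    show "D * (2 * (C * H) * D) < top"
      using C D H by (simp add: ennreal_mult_less_top)
  next
    fix c assume c: "enorm q (abs_ext \<Lambda>' c) < top"
    let ?c = "abs_ext \<Lambda>' c" and ?Ac = "abs_ext \<Lambda> (mat_apply \<Lambda>' a c)"
    let ?V = "block_norm p N ?c" and ?W = "block_norm p N ?Ac"
    have supp: "x \<notin> \<Lambda>' \<Longrightarrow> ?c x = 0" "x \<notin> \<Lambda> \<Longrightarrow> ?Ac x = 0" for x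
      by (simp_all add: abs_ext_def)
    \<comment> \<open>Finiteness of this norm is established first, since the absorption depends on
      it.\<close>
    have "enorm q ?V \<le> D * enorm q (block_norm q N ?c)"
      by (rule enorm_block_norm_compare[OF q p q supp(1) D'])
    also have "\<dots> < top"
      using c D by (simp add: enorm_block_norm[OF q] ennreal_mult_less_top)
    finally have V_fin: "enorm q ?V < top" .
    have "enorm q ?V \<le> enorm q (\<lambda>n. C * ((\<integral>\<^sup>+m. h (n - m) * ?W m \<partial>count_space UNIV)
        + (\<integral>\<^sup>+m. g (n - m) * ?V m \<partial>count_space UNIV)))"
      unfolding h_def g_def by (intro enorm_mono q local_estimate[OF N p q lower c \<beta>])
    also have "\<dots> \<le> C * (H * enorm q ?W + G * enorm q ?V)"
      unfolding enorm_cmult[OF q] H_def G_def using H G_fin unfolding H_def G_def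
      by (intro mult_left_mono order_trans[OF enorm_triangle[OF q]] add_mono enorm_convolution q) auto
    also have "\<dots> = C * H * enorm q ?W + C * G * enorm q ?V"
      by (simp add: distrib_left mult.assoc)
    finally have "enorm q ?V \<le> 2 * (C * H * enorm q ?W)"
      by (rule ennreal_absorb[OF V_fin _ CG])
    moreover have "enorm q ?c \<le> D * enorm q ?V"
      using enorm_block_norm_compare[OF p q q supp(1) D'] by (simp add: enorm_block_norm[OF q])
    moreover have "enorm q ?W \<le> D * enorm q ?Ac"
      using enorm_block_norm_compare[OF q p q supp(2) D''] by (simp add: enorm_block_norm[OF q])
    ultimately have "enorm q ?c \<le> D * (2 * (C * H * (D * enorm q ?Ac)))"
      by (meson mult_left_mono order_trans zero_le)
    then show "enorm q ?c \<le> D * (2 * (C * H) * D) * enorm q ?Ac"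
      by (simp add: mult_ac)
  qed
qed

end

section \<open>Assembling the upper and lower bounds\<close>

theorem theorem2p1:
  fixes \<Lambda> \<Lambda>' :: "(real ^ 'n) set"
    and a :: "real ^ 'n \<Rightarrow> real ^ 'n \<Rightarrow> complex"
  assumes "relatively_separated \<Lambda>" and "relatively_separated \<Lambda>'"
    and "a \<in> sjostrand_class \<Lambda> \<Lambda>'"
    and "\<exists>p. 1 \<le> p \<and> p \<le> \<infinity> \<and> ell_stable p \<Lambda> \<Lambda>' a"
  shows "\<forall>q. 1 \<le> q \<and> q \<le> \<infinity> \<longrightarrow> ell_stable q \<Lambda> \<Lambda>' a"
proof (intro allI impI)
  fix q :: ereal assume "1 \<le> q \<and> q \<le> \<infinity>"
  then have q: "1 \<le> q" by simp
  obtain p where p: "1 \<le> p" and "ell_stable p \<Lambda> \<Lambda>' a"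
    using assms(4) by auto
  then obtain C where C: "\<And>c. enorm p (abs_ext \<Lambda>' c) < top \<Longrightarrow>
      enorm p (abs_ext \<Lambda>' c) \<le> ennreal C * enorm p (abs_ext \<Lambda> (mat_apply \<Lambda>' a c))"
    by (auto simp: ell_stable_iff)
  obtain K1 where K1: "K1 < top"
    "\<And>x k. (\<integral>\<^sup>+\<mu>. indicator {\<mu> \<in> \<Lambda>. floor_vec (x - \<mu>) = k} \<mu> \<partial>count_space UNIV) \<le> K1"
    "\<And>x k. (\<integral>\<^sup>+\<mu>. indicator {\<mu> \<in> \<Lambda>. floor_vec (\<mu> - x) = k} \<mu> \<partial>count_space UNIV) \<le> K1"
    by (rule relatively_separated_count[OF assms(1)]) (rule that)
  obtain K2 where K2: "K2 < top"
    "\<And>x k. (\<integral>\<^sup>+\<mu>. indicator {\<mu> \<in> \<Lambda>'. floor_vec (x - \<mu>) = k} \<mu> \<partial>count_space UNIV) \<le> K2"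
    "\<And>x k. (\<integral>\<^sup>+\<mu>. indicator {\<mu> \<in> \<Lambda>'. floor_vec (\<mu> - x) = k} \<mu> \<partial>count_space UNIV) \<le> K2"
    by (rule relatively_separated_count[OF assms(2)]) (rule that)
  \<comment> \<open>The summands of the Sjostrand norm; they form the least majorant that depends
    only on the cube containing the difference of the indices.\<close>
  define \<alpha> where "\<alpha> k = (SUP (\<mu>, \<nu>) \<in> \<Lambda> \<times> \<Lambda>'.
    ennreal (norm (a \<mu> \<nu>)) * indicator ((+) (int_vec k) ` unit_cube) (\<mu> - \<nu>))" for k :: "int ^ 'n"
  interpret localized_matrix \<Lambda> \<Lambda>' a \<alpha> "max K1 K2"
  proof
    show "(\<integral>\<^sup>+k. \<alpha> k \<partial>count_space UNIV) < top"
      using assms(3) by (simp add: sjostrand_class_def sjostrand_norm_def \<alpha>_def nn_integral_eq_infsum_ennreal)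
    show "ennreal (norm (a \<mu> \<nu>)) \<le> \<alpha> (floor_vec (\<mu> - \<nu>))" if "\<mu> \<in> \<Lambda>" "\<nu> \<in> \<Lambda>'" for \<mu> \<nu>
      unfolding \<alpha>_def using that
      by (intro SUP_upper2[of "(\<mu>, \<nu>)"])
        (auto simp: mem_translate_unit_cube floor_vec_diff_int_vec)
  qed (use K1(1) K2(1) in simp, (rule order_trans[OF K1(2)] order_trans[OF K1(3)] order_trans[OF K2(2)] order_trans[OF K2(3)], simp)+)
  obtain B where B: "B < top" "\<And>c. enorm q (abs_ext \<Lambda>' c) < top \<Longrightarrow>
      enorm q (abs_ext \<Lambda>' c) \<le> B * enorm q (abs_ext \<Lambda> (mat_apply \<Lambda>' a c))"
    using lower_bound_transfer[OF p q _ C] by auto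
  \<comment> \<open>One constant for both bounds; the 1 keeps it positive, and its finiteness allows
    it to be read as a real number.\<close>
  define E where "E = max 1 (max B (max K1 K2 * (\<integral>\<^sup>+k. \<alpha> k \<partial>count_space UNIV)))"
  have E_ge: "B \<le> E" "max K1 K2 * (\<integral>\<^sup>+k. \<alpha> k \<partial>count_space UNIV) \<le> E"
    by (simp_all only: E_def le_max_iff_disj order_refl simp_thms)
  have "E < top"
    using B(1) K \<alpha> by (simp add: E_def ennreal_mult_less_top)
  then have E: "ennreal (enn2real E) = E"
    by simp
  moreover have "1 \<le> E"
    by (simp add: E_def)
  ultimately have pos: "0 < enn2real E"
    by (metis ennreal_0 enn2real_nonneg less_eq_real_def not_one_le_zero)
  show "ell_stable q \<Lambda> \<Lambda>' a"
    unfolding ell_stable_iff[OF q]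
  proof (intro exI[of _ "enn2real E"] conjI allI impI pos)
    fix c assume c: "enorm q (abs_ext \<Lambda>' c) < top"
    show upper: "enorm q (abs_ext \<Lambda> (mat_apply \<Lambda>' a c)) \<le> ennreal (enn2real E) * enorm q (abs_ext \<Lambda>' c)"
      unfolding E by (rule order_trans[OF enorm_mat_apply_le[OF q c] mult_right_mono[OF E_ge(2) zero_le]])
    show "enorm q (abs_ext \<Lambda> (mat_apply \<Lambda>' a c)) < top"
      by (rule order_le_less_trans[OF upper]) (use c in \<open>simp add: ennreal_mult_less_top\<close>)
    show "enorm q (abs_ext \<Lambda>' c) \<le> ennreal (enn2real E) * enorm q (abs_ext \<Lambda> (mat_apply \<Lambda>' a c))"
      unfolding E by (rule order_trans[OF B(2)[OF c] mult_right_mono[OF E_ge(1) zero_le]])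
  qed
qed

end
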